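(* In the reinforcement-learning network model described in the context, almost surely $F(x_n)\to 0$ and the distance from $x_n$ to $\Gamma$ tends to $0$ as $n\to\infty$.
   Context: Let $G=(\mathbb{V},E)$ be a finite graph with adjacency $i\sim j$ and (unordered) edge set $E$. Let $(a_{ij})_{i,j\in\mathbb{V}}$ be nonnegative reals with $a_{ij}=a_{ji}$ and $a_{ij}>0$ only if $i\sim j$. Let $(p_W)_{W\subseteq\mathbb{V}}$ be nonnegative reals with $\sum_W p_W=1$; for $i\sim j$ put $p_{ij}=\sum_{W:\, i,j\in W}p_W$, and $p_{ij}=0$ if $i\not\sim j$. Assume there exist $i,j$ with $a_{ij}p_{ij}>0$. Let $v^0_{ij}=v^0_{ji}\ge 0$ with $v^0_{ij}>0$ iff $i\sim j$. Process: $V^0_{ij}=v^0_{ij}$, $V^n_{ij}=0$ if $i\not\sim j$, $V_i^n=\sum_j V_{ij}^n$. At each time $n$, each vertex $i$ independently chooses a neighbour $j$ with probability $V_{ij}^n/V_i^n$; independently Nature picks $W_n\subseteq\mathbb{V}$ with $\mathbb{P}(W_n=W)=p_W$, i.i.d. in $n$; if $i,j\in W_n$, $i\sim j$ and $i,j$ choose each other then $V^{n+1}_{ij}=V^{n+1}_{ji}=V^n_{ij}+a_{ij}$, otherwise unchanged. So $\mathbb{P}(V_{ij}^{n+1}=V_{ij}^n+a_{ij}\mid\mathcal{F}_n)=p_{ij}(V_{ij}^n)^2/(V_i^nV_j^n)$. Let $T_n=\sum_{i,j}V_{ij}^n$ (ordered pairs), $x_{ij}^n=V_{ij}^n/T_n$,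 $x_n=(x^n_{ij})$. Let $h_1=\sum_{(i,j):a_{ij}p_{ij}>0}v^0_{ij}/\sum_{k,l}v^0_{kl}$ and let $\Delta$ be the set of arrays $x=(x_{ij})_{i,j\in\mathbb{V}}$ with $x_{ij}=x_{ji}\ge0$, $x_{ij}=0$ if $i\not\sim j$, $\sum_{i,j}x_{ij}=1$ and $\sum_{(i,j):a_{ij}p_{ij}>0}x_{ij}\ge h_1$; write $x_i=\sum_jx_{ij}$. Let $H(x)=\sum_{(i,j):x_{ij}>0}a_{ij}p_{ij}\frac{x_{ij}^2}{x_ix_j}$ and $F(x)_{ij}=x_{ij}\big(a_{ij}p_{ij}\frac{x_{ij}}{x_ix_j}-H(x)\big)$, with the conventions $F(x)_{ij}=0$ if $x_{ij}=0$ and $a_{ij}p_{ij}x_{ij}/(x_ix_j)=0$ if $a_{ij}p_{ij}=0$. Let $\Gamma=\{x\in\Delta: F(x)=0\}$. *)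

theory Defs
  imports "HOL-Probability.Probability"
begin

definition pp :: "('v::finite \<Rightarrow> 'v \<Rightarrow> bool) \<Rightarrow> ('v set \<Rightarrow> real) \<Rightarrow> 'v \<Rightarrow> 'v \<Rightarrow> real" where
  "pp adj p i j = (if adj i j then (\<Sum>W \<in> {W. i \<in> W \<and> j \<in> W}. p W) else 0)"

text \<open>Reinforcement process V^n, driven by the choice sequence c (c n i = neighbour chosen
  by i at time n) and Nature's sets w (w n = W_n).\<close>
fun Vproc :: "('v \<Rightarrow> 'v \<Rightarrow> bool) \<Rightarrow> ('v \<Rightarrow> 'v \<Rightarrow> real) \<Rightarrow> ('v \<Rightarrow> 'v \<Rightarrow> real)
    \<Rightarrow> (nat \<Rightarrow> 'v \<Rightarrow> 'v) \<Rightarrow> (nat \<Rightarrow> 'v set) \<Rightarrow> nat \<Rightarrow> 'v \<Rightarrow> 'v \<Rightarrow> real" where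
  "Vproc adj a v0 c w 0 = (\<lambda>i j. if adj i j then v0 i j else 0)"
| "Vproc adj a v0 c w (Suc n) = (\<lambda>i j. Vproc adj a v0 c w n i j +
      (if adj i j \<and> i \<in> w n \<and> j \<in> w n \<and> c n i = j \<and> c n j = i then a i j else 0))"

text \<open>Probability that vertex i chooses j given the current weights V
  (isolated vertices, which have V_i = 0, deterministically "choose" themselves).\<close>
definition choice_prob :: "('v::finite \<Rightarrow> 'v \<Rightarrow> real) \<Rightarrow> 'v \<Rightarrow> 'v \<Rightarrow> real" where
  "choice_prob V i j = (if (\<Sum>k\<in>UNIV. V i k) = 0 then (if j = i then 1 else 0)
                         else V i j / (\<Sum>k\<in>UNIV. V i k))"

definition xarr :: "('v::finite \<Rightarrow> 'v \<Rightarrow> real) \<Rightarrow> real^'v^'v" where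
  "xarr V = (\<chi> i j. V i j / (\<Sum>k\<in>UNIV. \<Sum>l\<in>UNIV. V k l))"

definition rowsum :: "real^'v::finite^'v \<Rightarrow> 'v \<Rightarrow> real" where
  "rowsum x i = (\<Sum>j\<in>UNIV. x $ i $ j)"

definition Hfun :: "('v::finite \<Rightarrow> 'v \<Rightarrow> bool) \<Rightarrow> ('v \<Rightarrow> 'v \<Rightarrow> real) \<Rightarrow> ('v set \<Rightarrow> real)
    \<Rightarrow> real^'v^'v \<Rightarrow> real" where
  "Hfun adj a p x = (\<Sum>(i,j) \<in> {(i,j). x $ i $ j > 0}.
       a i j * pp adj p i j * (x $ i $ j)^2 / (rowsum x i * rowsum x j))"

definition ratio :: "('v::finite \<Rightarrow> 'v \<Rightarrow> bool) \<Rightarrow> ('v \<Rightarrow> 'v \<Rightarrow> real) \<Rightarrow> ('v set \<Rightarrow> real)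
    \<Rightarrow> real^'v^'v \<Rightarrow> 'v \<Rightarrow> 'v \<Rightarrow> real" where
  "ratio adj a p x i j = (if a i j * pp adj p i j = 0 then 0
      else a i j * pp adj p i j * x $ i $ j / (rowsum x i * rowsum x j))"

definition Fmap :: "('v::finite \<Rightarrow> 'v \<Rightarrow> bool) \<Rightarrow> ('v \<Rightarrow> 'v \<Rightarrow> real) \<Rightarrow> ('v set \<Rightarrow> real)
    \<Rightarrow> real^'v^'v \<Rightarrow> real^'v^'v" where
  "Fmap adj a p x = (\<chi> i j. if x $ i $ j = 0 then 0
       else x $ i $ j * (ratio adj a p x i j - Hfun adj a p x))"

definition h1 :: "('v::finite \<Rightarrow> 'v \<Rightarrow> bool) \<Rightarrow> ('v \<Rightarrow> 'v \<Rightarrow> real) \<Rightarrow> ('v set \<Rightarrow> real)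
    \<Rightarrow> ('v \<Rightarrow> 'v \<Rightarrow> real) \<Rightarrow> real" where
  "h1 adj a p v0 = (\<Sum>(i,j) \<in> {(i,j). a i j * pp adj p i j > 0}. v0 i j)
                   / (\<Sum>k\<in>UNIV. \<Sum>l\<in>UNIV. v0 k l)"

definition Delta :: "('v::finite \<Rightarrow> 'v \<Rightarrow> bool) \<Rightarrow> ('v \<Rightarrow> 'v \<Rightarrow> real) \<Rightarrow> ('v set \<Rightarrow> real)
    \<Rightarrow> ('v \<Rightarrow> 'v \<Rightarrow> real) \<Rightarrow> (real^'v^'v) set" where
  "Delta adj a p v0 = {x. (\<forall>i j. x $ i $ j = x $ j $ i \<and> x $ i $ j \<ge> 0 \<and> (\<not> adj i j \<longrightarrow> x $ i $ j = 0))
      \<and> (\<Sum>i\<in>UNIV. \<Sum>j\<in>UNIV. x $ i $ j) = 1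
      \<and> (\<Sum>(i,j) \<in> {(i,j). a i j * pp adj p i j > 0}. x $ i $ j) \<ge> h1 adj a p v0}"

definition Gamma :: "('v::finite \<Rightarrow> 'v \<Rightarrow> bool) \<Rightarrow> ('v \<Rightarrow> 'v \<Rightarrow> real) \<Rightarrow> ('v set \<Rightarrow> real)
    \<Rightarrow> ('v \<Rightarrow> 'v \<Rightarrow> real) \<Rightarrow> (real^'v^'v) set" where
  "Gamma adj a p v0 = {x \<in> Delta adj a p v0. Fmap adj a p x = 0}"

end

theory Submission
  imports Defs
begin

text \<open>
  Write \<open>V\<^sub>i\<close> for the total weight at \<open>i\<close>, \<open>b\<^sub>i\<^sub>j = V\<^sub>i\<^sub>j / V\<^sub>i\<close> for the share of \<open>j\<close> and
  \<open>r\<^sub>i\<^sub>j = a\<^sub>i\<^sub>j p\<^sub>i\<^sub>j b\<^sub>i\<^sub>j b\<^sub>j\<^sub>i\<close> for the conditional mean gain of the edge, so that \<open>H\<close> is the sum of all \<open>r\<^sub>i\<^sub>j\<close>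
  and \<open>F\<^sub>i\<^sub>j = r\<^sub>i\<^sub>j - x\<^sub>i\<^sub>j H\<close>. The relative increments of every \<open>V\<^sub>i\<close> are square summable by a
  deterministic telescoping bound. Hence the martingale parts of the \<open>r\<^sub>i\<^sub>j\<close> and the second order
  errors converge almost surely, and since the first order drift \<open>D\<close> of \<open>H\<close> is a sum of
  variances divided by the \<open>V\<^sub>i\<close>, both \<open>H\<close> and the series of the \<open>D\<close> converge.

  The summability of \<open>D\<close> makes \<open>r\<^sub>i\<^sub>j\<close> nearly constant on windows \<open>{n..S n}\<close> as long as \<open>V\<^sub>i\<close> and \<open>V\<^sub>j\<close>
  are of order \<open>n\<close>. Vertices with \<open>V\<^sub>i\<close> much smaller than \<open>n\<close> are shown to have small rates by means of a
  gap between the scales of the \<open>V\<^sub>i\<close>. So all \<open>r\<^sub>i\<^sub>j\<close> vary slowly, which by the law of large numbers forces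
  \<open>V\<^sub>i\<^sub>j / n - r\<^sub>i\<^sub>j\<close> and then \<open>F\<close> to vanish in the limit. Although \<open>F\<close> is discontinuous, every limit
  point of \<open>x\<^sub>n\<close> is then a zero of \<open>F\<close>, and compactness gives the second claim.
\<close>

section \<open>Martingales over a finite alphabet\<close>

text \<open>Adaptedness: \<open>f\<close> is determined by the first \<open>n\<close> letters.
  Histories are total functions on \<open>nat\<close>, so conditional statements become pointwise
  statements about updated histories and no sub-sigma-algebra has to be handled.\<close>

definition dep :: "nat \<Rightarrow> ((nat \<Rightarrow> 's) \<Rightarrow> 'b) \<Rightarrow> bool" where
  "dep n f \<longleftrightarrow> (\<forall>h h'. (\<forall>k<n. h k = h' k) \<longrightarrow> f h = f h')"

lemma depD: "dep n f \<Longrightarrow> (\<And>k. k < n \<Longrightarrow> h k = h' k) \<Longrightarrow> f h = f h'"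
  unfolding dep_def by blast

lemma dep_const [intro]: "dep n (\<lambda>h. c)"
  by (simp add: dep_def)

lemma dep_mono: "dep m f \<Longrightarrow> m \<le> n \<Longrightarrow> dep n f"
  unfolding dep_def by (meson less_le_trans)

lemma dep_comp: "dep n f \<Longrightarrow> dep n (\<lambda>h. F (f h))"
  unfolding dep_def by metis

lemma dep_comp2: "dep n f \<Longrightarrow> dep n g \<Longrightarrow> dep n (\<lambda>h. F (f h) (g h))"
  unfolding dep_def by metis

lemma dep_mult: "dep n f \<Longrightarrow> dep n g \<Longrightarrow> dep n (\<lambda>h. f h * g h)"
  unfolding dep_def by metis

lemma dep_diff: "dep n f \<Longrightarrow> dep n g \<Longrightarrow> dep n (\<lambda>h. f h - g h)"
  unfolding dep_def by metis

lemma dep_power: "dep n f \<Longrightarrow> dep n (\<lambda>h. (f h) ^ k)"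
  unfolding dep_def by metis

lemma dep_sum: "(\<And>i. i \<in> I \<Longrightarrow> dep n (f i)) \<Longrightarrow> dep n (\<lambda>h. \<Sum>i\<in>I. f i h)"
  unfolding dep_def by (metis (no_types, lifting) sum.cong)

lemma dep_upd: "dep n f \<Longrightarrow> f (h(n := s)) = f h"
  by (rule depD) auto

text \<open>A process over a finite alphabet given by its transition kernel \<open>\<kappa>\<close>;
  the cylinder formula is the link between kernel and measure. By \<open>\<kappa>_dep\<close> the
  product in it reads only the letters of \<open>h\<close> before \<open>n\<close>.\<close>

locale finite_history = prob_space M
  for M :: "'w measure" +
  fixes X :: "nat \<Rightarrow> 'w \<Rightarrow> 's::finite"
    and \<kappa> :: "nat \<Rightarrow> (nat \<Rightarrow> 's) \<Rightarrow> 's \<Rightarrow> real"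
  assumes X_meas [measurable]: "\<And>k. X k \<in> measurable M (count_space UNIV)"
    and \<kappa>_dep: "\<And>n. dep n (\<kappa> n)"
    and \<kappa>_nonneg: "\<And>n h s. 0 \<le> \<kappa> n h s"
    and \<kappa>_sum: "\<And>n h. (\<Sum>s\<in>UNIV. \<kappa> n h s) = 1"
    and cylinder: "\<And>n h. measure M {\<omega> \<in> space M. \<forall>k<n. X k \<omega> = h k} = (\<Prod>k<n. \<kappa> k h (h k))"
begin

abbreviation path :: "'w \<Rightarrow> nat \<Rightarrow> 's" where "path \<omega> \<equiv> \<lambda>k. X k \<omega>"

text \<open>For \<open>dep (Suc n) f\<close> this is the conditional expectation of \<open>f\<close>
  given the first \<open>n\<close> letters. It is defined on every history, also on those of
  probability zero, so martingale identities hold identically instead of almost surely.\<close>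

definition step :: "nat \<Rightarrow> ((nat \<Rightarrow> 's) \<Rightarrow> real) \<Rightarrow> (nat \<Rightarrow> 's) \<Rightarrow> real" where
  "step n f h = (\<Sum>s\<in>UNIV. \<kappa> n h s * f (h(n := s)))"

lemma dep_step: assumes "dep (Suc n) f" shows "dep n (step n f)"
  unfolding dep_def step_def
proof (intro allI impI sum.cong refl)
  fix h h' :: "nat \<Rightarrow> 's" and s assume eq: "\<forall>k<n. h k = h' k"
  have "f (h(n := s)) = f (h'(n := s))"
    using assms by (rule depD) (use eq in auto)
  moreover have "\<kappa> n h = \<kappa> n h'"
    using \<kappa>_dep by (rule depD) (use eq in auto)
  ultimately show "\<kappa> n h s * f (h(n := s)) = \<kappa> n h' s * f (h'(n := s))" by simp
qed

lemma step_const: "dep n g \<Longrightarrow> step n g h = g h"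
  by (simp add: step_def dep_upd \<kappa>_sum flip: sum_distrib_right)

lemma step_mult: "dep n g \<Longrightarrow> step n (\<lambda>h. g h * f h) h = g h * step n f h"
  by (simp add: step_def dep_upd sum_distrib_left mult_ac)

lemma step_add: "step n (\<lambda>h. f h + g h) h = step n f h + step n g h"
  by (simp add: step_def sum.distrib algebra_simps)

lemma step_diff: "step n (\<lambda>h. f h - g h) h = step n f h - step n g h"
  by (simp add: step_def sum_subtractf algebra_simps)

lemma step_cmult: "step n (\<lambda>h. c * f h) h = c * step n f h"
  by (simp add: step_def sum_distrib_left mult_ac)

lemma step_sum: "step n (\<lambda>h. \<Sum>i\<in>I. f i h) h = (\<Sum>i\<in>I. step n (f i) h)"
  unfolding step_def sum_distrib_left by (rule sum.swap)

lemma step_mono: "(\<And>s. f (h(n := s)) \<le> g (h(n := s))) \<Longrightarrow> step n f h \<le> step n g h"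
  unfolding step_def by (intro sum_mono mult_left_mono \<kappa>_nonneg)

lemma step_cong: "(\<And>s. f (h(n := s)) = g (h(n := s))) \<Longrightarrow> step n f h = step n g h"
  unfolding step_def by simp

lemma step_nonneg: "(\<And>h. 0 \<le> f h) \<Longrightarrow> 0 \<le> step n f h"
  unfolding step_def by (intro sum_nonneg mult_nonneg_nonneg \<kappa>_nonneg)

lemma abs_step_le: "\<bar>step n f h\<bar> \<le> step n (\<lambda>h. \<bar>f h\<bar>) h"
  unfolding step_def
  by (rule order_trans[OF sum_abs]) (simp add: abs_mult \<kappa>_nonneg)

section \<open>Cylinder sets, expectations and the tower property\<close>

definition prefixes :: "nat \<Rightarrow> (nat \<Rightarrow> 's) set" where
  "prefixes n = PiE {..<n} (\<lambda>_. UNIV)"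

lemma finite_prefixes [simp]: "finite (prefixes n)"
  by (simp add: prefixes_def finite_PiE)

definition cyl :: "nat \<Rightarrow> (nat \<Rightarrow> 's) \<Rightarrow> 'w set" where
  "cyl n e = {\<omega> \<in> space M. \<forall>k<n. X k \<omega> = e k}"

lemma cyl_sets [measurable]: "cyl n e \<in> sets M"
  unfolding cyl_def by measurable

text \<open>A function of finitely many letters is a finite linear combination of indicators of
  cylinders, which yields measurability, integrability and a formula for the expectation. The
  elements of \<open>prefixes n\<close> are \<open>undefined\<close> from \<open>n\<close> on;
  \<open>dep n f\<close> makes these values harmless.\<close>

lemma path_expand:
  assumes "dep n f" "\<omega> \<in> space M"
  shows "(f (path \<omega>) :: real) = (\<Sum>e\<in>prefixes n. f e * indicator (cyl n e) \<omega>)"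
proof -
  let ?r = "restrict (path \<omega>) {..<n}"
  have r: "?r \<in> prefixes n" by (auto simp: prefixes_def)
  have uniq: "e = ?r" if "e \<in> prefixes n" "\<omega> \<in> cyl n e" for e
    using that unfolding prefixes_def cyl_def
    by (intro ext) (auto simp: restrict_def PiE_def extensional_def)
  have "f e * indicator (cyl n e) \<omega> = 0" if "e \<in> prefixes n - {?r}" for e
    using that uniq[of e] by (cases "\<omega> \<in> cyl n e") auto
  then have "(\<Sum>e\<in>prefixes n. f e * indicator (cyl n e) \<omega>) = (\<Sum>e\<in>{?r}. f e * indicator (cyl n e) \<omega>)"
    using r by (intro sum.mono_neutral_right) auto
  also have "\<dots> = f ?r" using assms(2) by (auto simp: cyl_def)
  also have "\<dots> = f (path \<omega>)" using assms(1) by (rule depD) auto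
  finally show ?thesis by simp
qed

lemma path_measurable: "dep n f \<Longrightarrow> (\<lambda>\<omega>. f (path \<omega>) :: real) \<in> borel_measurable M"
  by (subst measurable_cong[OF path_expand])
     (auto intro!: borel_measurable_sum borel_measurable_times borel_measurable_indicator simp del: sum_mult_indicator)

lemma path_integrable: "dep n f \<Longrightarrow> integrable M (\<lambda>\<omega>. f (path \<omega>) :: real)"
  by (subst Bochner_Integration.integrable_cong[OF refl path_expand])
     (auto intro!: Bochner_Integration.integrable_sum integrable_mult_right integrable_real_indicator
       simp: emeasure_eq_measure simp del: sum_mult_indicator)

lemma path_expectation:
  assumes "dep n f"
  shows "expectation (\<lambda>\<omega>. f (path \<omega>)) = (\<Sum>e\<in>prefixes n. f e * measure M (cyl n e))"
proof -
  have "expectation (\<lambda>\<omega>. f (path \<omega>)) =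
      expectation (\<lambda>\<omega>. \<Sum>e\<in>prefixes n. f e * indicator (cyl n e) \<omega>)"
    by (intro Bochner_Integration.integral_cong refl path_expand assms)
  also have "\<dots> = (\<Sum>e\<in>prefixes n. f e * measure M (cyl n e))"
    by (subst Bochner_Integration.integral_sum)
       (auto intro!: integrable_mult_right integrable_real_indicator simp: emeasure_eq_measure)
  finally show ?thesis .
qed

lemma measure_cyl_Suc: "measure M (cyl (Suc n) (e(n := s))) = measure M (cyl n e) * \<kappa> n e s"
proof -
  have "\<kappa> k (e(n := s)) = \<kappa> k e" if "k \<le> n" for k
    using \<kappa>_dep by (rule depD) (use that in auto)
  then show ?thesis
    unfolding cyl_def cylinder by (simp add: prod.lessThan_Suc del: fun_upd_apply) simp
qed

text \<open>The tower property. A prefix of length \<open>Suc n\<close> is a prefix of length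
  \<open>n\<close> with one more letter, and the measure of its cylinder gains the factor
  \<open>\<kappa> n e s\<close>; summing over the last letter first leaves
  \<open>step n f\<close>.\<close>

lemma expectation_step:
  assumes f: "dep (Suc n) f"
  shows "expectation (\<lambda>\<omega>. f (path \<omega>)) = expectation (\<lambda>\<omega>. step n f (path \<omega>))"
proof -
  have inj: "inj_on (\<lambda>(s, e). e(n := s)) (UNIV \<times> prefixes n)"
    unfolding prefixes_def by (rule inj_combinator[of n]) simp
  have img: "prefixes (Suc n) = (\<lambda>(s, e). e(n := s)) ` (UNIV \<times> prefixes n)"
    unfolding prefixes_def lessThan_Suc by (simp add: PiE_insert_eq)
  have "expectation (\<lambda>\<omega>. f (path \<omega>))
      = (\<Sum>(s, e)\<in>UNIV \<times> prefixes n. f (e(n := s)) * (measure M (cyl n e) * \<kappa> n e s))"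
    unfolding path_expectation[OF f] img sum.reindex[OF inj]
    by (intro sum.cong refl) (auto simp: measure_cyl_Suc)
  also have "\<dots> = (\<Sum>e\<in>prefixes n. step n f e * measure M (cyl n e))"
    unfolding sum.cartesian_product[symmetric] step_def sum_distrib_right
    by (subst sum.swap) (simp add: mult_ac)
  also have "\<dots> = expectation (\<lambda>\<omega>. step n f (path \<omega>))"
    by (rule path_expectation[OF dep_step[OF f], symmetric])
  finally show ?thesis .
qed

text \<open>By the tower property the compensators have the same expected partial sums as the
  \<open>g k\<close>, hence at most \<open>B\<close>. Exchanging sum and integral, the total
  compensator has finite mean and so is finite almost surely.\<close>

lemma AE_summable_step:
  assumes g: "\<And>k. dep (Suc k) (g k)" and nonneg: "\<And>k h. 0 \<le> g k h"
    and bound: "\<And>n h. (\<Sum>k<n. g k h) \<le> B"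
  shows "AE \<omega> in M. summable (\<lambda>k. step k (g k) (path \<omega>))"
proof -
  let ?s = "\<lambda>k \<omega>. step k (g k) (path \<omega>)"
  have meas [measurable]: "?s k \<in> borel_measurable M" for k
    by (rule path_measurable[OF dep_step[OF g]])
  have part: "(\<Sum>k<n. \<integral>\<^sup>+\<omega>. ennreal (?s k \<omega>) \<partial>M) \<le> ennreal B" for n
  proof -
    have "(\<Sum>k<n. \<integral>\<^sup>+\<omega>. ennreal (?s k \<omega>) \<partial>M) = (\<Sum>k<n. ennreal (expectation (?s k)))"
      by (intro sum.cong refl nn_integral_eq_integral path_integrable[OF dep_step[OF g]])
         (simp add: step_nonneg nonneg)
    also have "\<dots> = ennreal (\<Sum>k<n. expectation (?s k))"
      by (intro sum_ennreal Bochner_Integration.integral_nonneg step_nonneg nonneg)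
    also have "(\<Sum>k<n. expectation (?s k)) = (\<Sum>k<n. expectation (\<lambda>\<omega>. g k (path \<omega>)))"
      by (simp add: expectation_step[OF g])
    also have "\<dots> = expectation (\<lambda>\<omega>. \<Sum>k<n. g k (path \<omega>))"
      by (subst Bochner_Integration.integral_sum) (auto intro: path_integrable[OF g])
    also have "\<dots> \<le> expectation (\<lambda>\<omega>. B)"
      by (intro integral_mono Bochner_Integration.integrable_sum path_integrable[OF g]) (auto simp: bound)
    also have "\<dots> = B" by (simp add: prob_space)
    finally show ?thesis by (simp add: ennreal_leI)
  qed
  have "(\<integral>\<^sup>+\<omega>. (\<Sum>k. ennreal (?s k \<omega>)) \<partial>M) = (\<Sum>k. \<integral>\<^sup>+\<omega>. ennreal (?s k \<omega>) \<partial>M)"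
    by (rule nn_integral_suminf) auto
  also have "\<dots> \<le> ennreal B" by (rule suminf_le_const[OF summableI part])
  finally have "(\<integral>\<^sup>+\<omega>. (\<Sum>k. ennreal (?s k \<omega>)) \<partial>M) \<noteq> \<infinity>"
    by (auto simp: top_unique)
  then have "AE \<omega> in M. (\<Sum>k. ennreal (?s k \<omega>)) \<noteq> \<infinity>"
    by (intro nn_integral_noteq_infinite) auto
  then show ?thesis
    by eventually_elim (rule summable_suminf_not_top, auto simp: step_nonneg nonneg)
qed

section \<open>Maximal inequality and convergence of martingales\<close>

lemma martingale_square_sum:
  assumes Y: "\<And>k. dep (Suc k) (Y k)" and mart: "\<And>k h. step k (Y k) h = 0"
  shows "expectation (\<lambda>\<omega>. (\<Sum>k<n. Y k (path \<omega>))\<^sup>2) = (\<Sum>k<n. expectation (\<lambda>\<omega>. (Y k (path \<omega>))\<^sup>2))"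
proof (induction n)
  case (Suc n)
  let ?S = "\<lambda>h. \<Sum>k<n. Y k h"
  have S: "dep n ?S" by (intro dep_sum dep_mono[OF Y]) auto
  have S': "dep (Suc n) ?S" by (rule dep_mono[OF S]) simp
  have d1: "dep n (\<lambda>h. (?S h)\<^sup>2)" by (rule dep_power[OF S])
  have d2: "dep (Suc n) (\<lambda>h. (2 * ?S h) * Y n h)" by (intro dep_mult dep_const S' Y)
  have d3: "dep (Suc n) (\<lambda>h. (Y n h)\<^sup>2)" by (rule dep_power[OF Y])
  \<comment> \<open>Given the first \<open>n\<close> letters the partial sum is a constant and the
    next increment has mean zero, so the increments are orthogonal.\<close>
  have cross: "expectation (\<lambda>\<omega>. (2 * ?S (path \<omega>)) * Y n (path \<omega>)) = 0"
    unfolding expectation_step[OF d2]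
    by (subst step_mult[OF dep_mult[OF dep_const S]]) (simp add: mart)
  have "expectation (\<lambda>\<omega>. (\<Sum>k<Suc n. Y k (path \<omega>))\<^sup>2)
      = expectation (\<lambda>\<omega>. ((?S (path \<omega>))\<^sup>2 + (2 * ?S (path \<omega>)) * Y n (path \<omega>)) + (Y n (path \<omega>))\<^sup>2)"
    by (intro Bochner_Integration.integral_cong refl) (simp add: power2_eq_square algebra_simps)
  also have "\<dots> = expectation (\<lambda>\<omega>. (?S (path \<omega>))\<^sup>2) + expectation (\<lambda>\<omega>. (2 * ?S (path \<omega>)) * Y n (path \<omega>))
      + expectation (\<lambda>\<omega>. (Y n (path \<omega>))\<^sup>2)"
    using path_integrable[OF d1] path_integrable[OF d2] path_integrable[OF d3] by simp
  finally show ?case using Suc.IH cross by simp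
qed simp

text \<open>The process stopped on leaving the strip is again a martingale, so Chebyshev's inequality
  for its endpoint controls the maximum.\<close>
lemma kolmogorov_maximal:
  assumes Y: "\<And>k. dep (Suc k) (Y k)" and mart: "\<And>k h. step k (Y k) h = 0" and "0 < \<epsilon>"
  shows "prob {\<omega> \<in> space M. \<exists>n\<le>N. \<epsilon> \<le> \<bar>\<Sum>k<n. Y k (path \<omega>)\<bar>}
    \<le> (\<Sum>k<N. expectation (\<lambda>\<omega>. (Y k (path \<omega>))\<^sup>2)) / \<epsilon>\<^sup>2"
proof -
  \<comment> \<open>\<open>G k\<close> marks the histories whose partial sums up to index
    \<open>k\<close> have stayed inside the strip. The partial sum with index \<open>k\<close> ends
    before increment \<open>k\<close>, so \<open>G k\<close> is known before that increment is
    drawn.\<close>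
  define G where "G k h = (if \<forall>n\<le>k. \<bar>\<Sum>j<n. Y j h\<bar> < \<epsilon> then 1 else 0 :: real)" for k h
  define Z where "Z k h = G k h * Y k h" for k h
  define S where "S n h = (\<Sum>k<n. Z k h)" for n h
  have dS: "dep n (\<lambda>h. \<Sum>j<n. Y j h)" for n by (intro dep_sum dep_mono[OF Y]) auto
  have dG: "dep k (G k)" for k
    unfolding G_def dep_def
  proof (intro allI impI)
    fix h h' :: "nat \<Rightarrow> 's" assume "\<forall>i<k. h i = h' i"
    then have "(\<Sum>j<n. Y j h) = (\<Sum>j<n. Y j h')" if "n \<le> k" for n
      using dS[of n] that by (intro depD[OF dS]) auto
    then show "(if \<forall>n\<le>k. \<bar>\<Sum>j<n. Y j h\<bar> < \<epsilon> then 1 else 0 :: real)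
        = (if \<forall>n\<le>k. \<bar>\<Sum>j<n. Y j h'\<bar> < \<epsilon> then 1 else 0)" by auto
  qed
  have dZ: "dep (Suc k) (Z k)" for k
    unfolding Z_def by (intro dep_mult Y dep_mono[OF dG]) simp
  have mZ: "step k (Z k) h = 0" for k h
    unfolding Z_def by (simp add: step_mult[OF dG] mart)
  have dSS: "dep N (S N)" unfolding S_def by (intro dep_sum dep_mono[OF dZ]) auto
  have G_cases: "G k h = 0 \<or> G k h = 1" for k h by (simp add: G_def)
  have stopped: "\<epsilon> \<le> \<bar>S N h\<bar>" if ex: "\<exists>n\<le>N. \<epsilon> \<le> \<bar>\<Sum>k<n. Y k h\<bar>" for h
  proof -
    \<comment> \<open>At the first exit index the switch \<open>G\<close> has been on for all
      increments below \<open>n\<close> and is off from \<open>n\<close> on, so the stopped sum is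
      frozen at the exit value.\<close>
    define n where "n = (LEAST n. \<epsilon> \<le> \<bar>\<Sum>k<n. Y k h\<bar>)"
    have n: "\<epsilon> \<le> \<bar>\<Sum>k<n. Y k h\<bar>" using ex unfolding n_def by (auto intro: LeastI)
    have nN: "n \<le> N" using ex unfolding n_def by (meson Least_le order_trans)
    have below: "\<bar>\<Sum>k<m. Y k h\<bar> < \<epsilon>" if "m < n" for m
      using not_less_Least[OF that[unfolded n_def]] by simp
    have "S N h = (\<Sum>k<n. Z k h)" unfolding S_def
    proof (rule sum.mono_neutral_right)
      show "\<forall>k\<in>{..<N} - {..<n}. Z k h = 0"
        using n by (auto simp: Z_def G_def not_less)
    qed (use nN in auto)
    also have "\<dots> = (\<Sum>k<n. Y k h)"
      by (intro sum.cong refl) (use below in \<open>auto simp: Z_def G_def\<close>)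
    finally show ?thesis using n by simp
  qed
  have mS [measurable]: "(\<lambda>\<omega>. S N (path \<omega>)) \<in> borel_measurable M" by (rule path_measurable[OF dSS])
  have iS: "integrable M (\<lambda>\<omega>. (S N (path \<omega>))\<^sup>2)" by (rule path_integrable[OF dep_power[OF dSS]])
  have "prob {\<omega> \<in> space M. \<exists>n\<le>N. \<epsilon> \<le> \<bar>\<Sum>k<n. Y k (path \<omega>)\<bar>}
      \<le> prob {\<omega> \<in> space M. \<epsilon>\<^sup>2 \<le> (S N (path \<omega>))\<^sup>2}"
    by (rule finite_measure_mono) (use stopped \<open>0 < \<epsilon>\<close> in \<open>auto simp: abs_le_square_iff[symmetric]\<close>)
  also have "\<dots> \<le> expectation (\<lambda>\<omega>. (S N (path \<omega>))\<^sup>2) / \<epsilon>\<^sup>2"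
    by (rule integral_Markov_inequality_measure[OF iS, of "space M"]) (use \<open>0 < \<epsilon>\<close> in auto)
  also have "expectation (\<lambda>\<omega>. (S N (path \<omega>))\<^sup>2) = (\<Sum>k<N. expectation (\<lambda>\<omega>. (Z k (path \<omega>))\<^sup>2))"
    unfolding S_def by (rule martingale_square_sum[OF dZ mZ])
  also have "\<dots> \<le> (\<Sum>k<N. expectation (\<lambda>\<omega>. (Y k (path \<omega>))\<^sup>2))"
  proof (intro sum_mono integral_mono)
    fix k \<omega>
    show "integrable M (\<lambda>\<omega>. (Z k (path \<omega>))\<^sup>2)" by (rule path_integrable[OF dep_power[OF dZ]])
    show "integrable M (\<lambda>\<omega>. (Y k (path \<omega>))\<^sup>2)" by (rule path_integrable[OF dep_power[OF Y]])
    show "(Z k (path \<omega>))\<^sup>2 \<le> (Y k (path \<omega>))\<^sup>2" using G_cases[of k "path \<omega>"] by (auto simp: Z_def)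
  qed
  finally show ?thesis by (simp add: divide_right_mono)
qed

text \<open>The maximal inequality after index \<open>m\<close> bounds the probability of a later
  fluctuation of size \<open>\<epsilon>\<close> by a tail of the variance series. The tails tend to
  zero, so almost every path is Cauchy.\<close>

lemma martingale_convergence:
  assumes Y: "\<And>k. dep (Suc k) (Y k)" and mart: "\<And>k h. step k (Y k) h = 0"
    and summ: "summable (\<lambda>k. expectation (\<lambda>\<omega>. (Y k (path \<omega>))\<^sup>2))"
  shows "AE \<omega> in M. convergent (\<lambda>n. \<Sum>k<n. Y k (path \<omega>))"
proof -
  let ?E = "\<lambda>k. expectation (\<lambda>\<omega>. (Y k (path \<omega>))\<^sup>2)"
  let ?S = "\<lambda>n \<omega>. \<Sum>k<n. Y k (path \<omega>)"
  have E0: "0 \<le> ?E k" for k by simp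
  have mS [measurable]: "?S n \<in> borel_measurable M" for n
    by (intro borel_measurable_sum path_measurable[OF Y])
  have max: "prob {\<omega> \<in> space M. \<exists>n. m \<le> n \<and> \<epsilon> \<le> \<bar>?S n \<omega> - ?S m \<omega>\<bar>} \<le> (\<Sum>k. ?E (k + m)) / \<epsilon>\<^sup>2"
    if "0 < \<epsilon>" for m and \<epsilon> :: real
  proof -
    \<comment> \<open>Deleting the increments before \<open>m\<close> leaves a martingale whose
      partial sums are the differences \<open>?S n - ?S m\<close> for
      \<open>m \<le> n\<close>.\<close>
    define Z where "Z k h = (if k < m then 0 else Y k h)" for k h
    have dZ: "dep (Suc k) (Z k)" for k using dep_comp[OF Y[of k], of "\<lambda>y. if k < m then 0 else y"] by (simp add: Z_def[abs_def])
    have mZ: "step k (Z k) h = 0" for k h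
      using mart[of k h] by (cases "k < m") (simp_all add: Z_def step_def)
    have SZ: "(\<Sum>k<n. Z k (path \<omega>)) = ?S n \<omega> - ?S m \<omega>" if "m \<le> n" for n \<omega>
    proof -
      have "(\<Sum>k<n. Z k (path \<omega>)) = (\<Sum>k\<in>{m..<n}. Y k (path \<omega>))"
        by (rule sum.mono_neutral_cong_right) (auto simp: Z_def)
      also have "\<dots> = ?S n \<omega> - ?S m \<omega>"
        using that by (simp add: sum_diff_nat_ivl lessThan_atLeast0)
      finally show ?thesis .
    qed
    let ?A = "\<lambda>N. {\<omega> \<in> space M. \<exists>n\<le>N. \<epsilon> \<le> \<bar>\<Sum>k<n. Z k (path \<omega>)\<bar>}"
    have mZZ [measurable]: "(\<lambda>\<omega>. Z k (path \<omega>)) \<in> borel_measurable M" for k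
      by (rule path_measurable[OF dZ])
    have lim: "(\<lambda>N. prob (?A N)) \<longlonglongrightarrow> prob (\<Union>N. ?A N)"
      by (rule finite_Lim_measure_incseq) (auto simp: incseq_def, measurable, meson order_trans)
    have tail: "prob (?A N) \<le> (\<Sum>k. ?E (k + m)) / \<epsilon>\<^sup>2" for N
    proof -
      have "prob (?A N) \<le> (\<Sum>k<N. expectation (\<lambda>\<omega>. (Z k (path \<omega>))\<^sup>2)) / \<epsilon>\<^sup>2"
        by (rule kolmogorov_maximal[OF dZ mZ that])
      also have "(\<Sum>k<N. expectation (\<lambda>\<omega>. (Z k (path \<omega>))\<^sup>2)) \<le> (\<Sum>k<N+m. expectation (\<lambda>\<omega>. (Z k (path \<omega>))\<^sup>2))"
        by (rule sum_mono2) auto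
      also have "\<dots> = (\<Sum>k\<in>{m..<N+m}. ?E k)"
        by (rule sum.mono_neutral_cong_right) (auto simp: Z_def)
      also have "\<dots> = (\<Sum>k<N. ?E (k + m))"
        using sum.shift_bounds_nat_ivl[of ?E 0 m N] by (simp add: lessThan_atLeast0)
      also have "\<dots> \<le> (\<Sum>k. ?E (k + m))"
        by (rule sum_le_suminf) (use summ summable_iff_shift[of ?E m] E0 in auto)
      finally show ?thesis by (simp add: divide_right_mono)
    qed
    have "prob {\<omega> \<in> space M. \<exists>n. m \<le> n \<and> \<epsilon> \<le> \<bar>?S n \<omega> - ?S m \<omega>\<bar>} \<le> prob (\<Union>N. ?A N)"
      by (rule finite_measure_mono) (auto simp flip: SZ, use order_refl in blast)
    also have "\<dots> \<le> (\<Sum>k. ?E (k + m)) / \<epsilon>\<^sup>2"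
      by (rule LIMSEQ_le_const2[OF lim]) (use tail in auto)
    finally show ?thesis .
  qed
  have tail0: "(\<lambda>m. \<Sum>k. ?E (k + m)) \<longlonglongrightarrow> 0"
    using suminf_exist_split2[OF summ] by simp
  have ae: "AE \<omega> in M. \<exists>m. \<forall>n\<ge>m. \<bar>?S n \<omega> - ?S m \<omega>\<bar> < \<epsilon>" if "0 < \<epsilon>" for \<epsilon> :: real
  proof -
    \<comment> \<open>The paths that fluctuate by \<open>\<epsilon>\<close> after every index. This
      event lies in each of the events bounded by \<open>max\<close>, so its probability is below
      every tail.\<close>
    let ?B = "{\<omega> \<in> space M. \<forall>m. \<exists>n. m \<le> n \<and> \<epsilon> \<le> \<bar>?S n \<omega> - ?S m \<omega>\<bar>}"
    have "prob ?B \<le> (\<Sum>k. ?E (k + m)) / \<epsilon>\<^sup>2" for m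
    proof -
      have "prob ?B \<le> prob {\<omega> \<in> space M. \<exists>n. m \<le> n \<and> \<epsilon> \<le> \<bar>?S n \<omega> - ?S m \<omega>\<bar>}"
        by (rule finite_measure_mono) (auto, measurable)
      then show ?thesis using max[OF that, of m] by simp
    qed
    moreover have "(\<lambda>m. (\<Sum>k. ?E (k + m)) / \<epsilon>\<^sup>2) \<longlonglongrightarrow> 0"
      using tendsto_divide[OF tail0 tendsto_const, of "\<epsilon>\<^sup>2"] that by simp
    ultimately have "prob ?B \<le> 0" by (intro LIMSEQ_le_const) auto
    then have "prob ?B = 0" by (simp add: measure_le_0_iff)
    moreover have "?B \<in> events" by measurable
    ultimately have "AE \<omega> in M. \<omega> \<notin> ?B" by (rule prob_eq_0[THEN iffD1, rotated])
    with AE_space show ?thesis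
    proof eventually_elim
      case (elim \<omega>)
      then obtain m where "\<not> (\<exists>n. m \<le> n \<and> \<epsilon> \<le> \<bar>?S n \<omega> - ?S m \<omega>\<bar>)" by blast
      then show ?case by (intro exI[of _ m]) (meson not_le)
    qed
  qed
  have "AE \<omega> in M. \<forall>r. \<exists>m. \<forall>n\<ge>m. \<bar>?S n \<omega> - ?S m \<omega>\<bar> < inverse (real (Suc r))"
    unfolding AE_all_countable by (intro allI ae) simp
  then show ?thesis
  proof eventually_elim
    case (elim \<omega>)
    have "Cauchy (\<lambda>n. ?S n \<omega>)"
      unfolding Cauchy_altdef2
    proof (intro allI impI)
      fix e :: real assume "0 < e"
      then obtain r where "inverse (real (Suc r)) < e" using reals_Archimedean by blast
      moreover obtain m where "\<forall>n\<ge>m. \<bar>?S n \<omega> - ?S m \<omega>\<bar> < inverse (real (Suc r))"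
        using elim by blast
      ultimately show "\<exists>N. \<forall>n\<ge>N. dist (?S n \<omega>) (?S N \<omega>) < e"
        unfolding dist_real_def by (intro exI[of _ m]) force
    qed
    then show ?case by (simp add: Cauchy_convergent_iff)
  qed
qed

text \<open>Centring does not increase the conditional second moment. A bound on the sum of squares
  that holds on every history therefore gives the square summability required for martingale
  convergence.\<close>

lemma compensated_convergence:
  assumes f: "\<And>k. dep (Suc k) (f k)" and bound: "\<And>n h. (\<Sum>k<n. (f k h)\<^sup>2) \<le> B"
  shows "AE \<omega> in M. convergent (\<lambda>n. \<Sum>k<n. f k (path \<omega>) - step k (f k) (path \<omega>))"
proof -
  define Y where "Y k h = f k h - step k (f k) h" for k h
  have ds: "dep k (step k (f k))" for k by (rule dep_step[OF f])
  have dY: "dep (Suc k) (Y k)" for k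
    unfolding Y_def by (intro dep_diff f dep_mono[OF ds]) simp
  have mY: "step k (Y k) h = 0" for k h
    unfolding Y_def by (simp add: step_diff step_const[OF ds])
  have sq: "step k (\<lambda>h. (Y k h)\<^sup>2) h \<le> step k (\<lambda>h. (f k h)\<^sup>2) h" for k h
  proof -
    have "step k (\<lambda>h. (Y k h)\<^sup>2) h
        = step k (\<lambda>h. ((f k h)\<^sup>2 - (2 * step k (f k) h) * f k h) + (step k (f k) h)\<^sup>2) h"
      by (simp add: Y_def power2_diff algebra_simps)
    also have "\<dots> = step k (\<lambda>h. (f k h)\<^sup>2) h - (2 * step k (f k) h) * step k (f k) h + (step k (f k) h)\<^sup>2"
      by (simp only: step_add step_diff step_mult[OF dep_mult[OF dep_const ds]]
            step_const[OF dep_power[OF ds]])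
    also have "\<dots> = step k (\<lambda>h. (f k h)\<^sup>2) h - (step k (f k) h)\<^sup>2" by (simp add: power2_eq_square)
    finally show ?thesis by simp
  qed
  have d2: "dep (Suc k) (\<lambda>h. (f k h)\<^sup>2)" for k by (rule dep_power[OF f])
  have dY2: "dep (Suc k) (\<lambda>h. (Y k h)\<^sup>2)" for k by (rule dep_power[OF dY])
  have le: "expectation (\<lambda>\<omega>. (Y k (path \<omega>))\<^sup>2) \<le> expectation (\<lambda>\<omega>. (f k (path \<omega>))\<^sup>2)" for k
    unfolding expectation_step[OF d2] expectation_step[OF dY2]
    by (intro integral_mono path_integrable[OF dep_step] d2 dY2 sq)
  have "summable (\<lambda>k. expectation (\<lambda>\<omega>. (Y k (path \<omega>))\<^sup>2))"
  proof (rule summableI_nonneg_bounded)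
    fix n
    have "(\<Sum>k<n. expectation (\<lambda>\<omega>. (Y k (path \<omega>))\<^sup>2)) \<le> (\<Sum>k<n. expectation (\<lambda>\<omega>. (f k (path \<omega>))\<^sup>2))"
      by (intro sum_mono le)
    also have "\<dots> = expectation (\<lambda>\<omega>. \<Sum>k<n. (f k (path \<omega>))\<^sup>2)"
      by (subst Bochner_Integration.integral_sum) (auto intro: path_integrable[OF d2])
    also have "\<dots> \<le> expectation (\<lambda>\<omega>. B)"
      by (intro integral_mono Bochner_Integration.integrable_sum path_integrable[OF d2]) (auto simp: bound)
    also have "\<dots> = B" by (simp add: prob_space)
    finally show "(\<Sum>k<n. expectation (\<lambda>\<omega>. (Y k (path \<omega>))\<^sup>2)) \<le> B" .
  qed simp
  from martingale_convergence[OF dY mY this] show ?thesis by (simp add: Y_def)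
qed

end

section \<open>The rates and their differentials\<close>

definition wdeg :: "('v::finite \<Rightarrow> 'v \<Rightarrow> real) \<Rightarrow> 'v \<Rightarrow> real" where
  "wdeg V i = (\<Sum>j\<in>UNIV. V i j)"

definition share :: "('v::finite \<Rightarrow> 'v \<Rightarrow> real) \<Rightarrow> 'v \<Rightarrow> 'v \<Rightarrow> real" where
  "share V i j = V i j / wdeg V i"

definition rate :: "('v::finite \<Rightarrow> 'v \<Rightarrow> real) \<Rightarrow> ('v \<Rightarrow> 'v \<Rightarrow> real) \<Rightarrow> 'v \<Rightarrow> 'v \<Rightarrow> real" where
  "rate q V i j = q i j * share V i j * share V j i"

text \<open>The differentials of \<^const>\<open>share\<close> and \<^const>\<open>rate\<close> at \<open>V\<close> in direction \<open>U\<close>.\<close>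
definition dshare :: "('v::finite \<Rightarrow> 'v \<Rightarrow> real) \<Rightarrow> ('v \<Rightarrow> 'v \<Rightarrow> real) \<Rightarrow> 'v \<Rightarrow> 'v \<Rightarrow> real" where
  "dshare V U i j = (U i j - share V i j * wdeg U i) / wdeg V i"

definition drate :: "('v::finite \<Rightarrow> 'v \<Rightarrow> real) \<Rightarrow> ('v \<Rightarrow> 'v \<Rightarrow> real) \<Rightarrow> ('v \<Rightarrow> 'v \<Rightarrow> real) \<Rightarrow> 'v \<Rightarrow> 'v \<Rightarrow> real" where
  "drate q V U i j = q i j * (share V i j * dshare V U j i + share V j i * dshare V U i j)"

lemma wdeg_nonneg: "(\<And>i j. 0 \<le> V i j) \<Longrightarrow> 0 \<le> wdeg V i"
  by (simp add: wdeg_def sum_nonneg)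

lemma entry_le_wdeg: "(\<And>i j. 0 \<le> V i j) \<Longrightarrow> V i j \<le> wdeg V i"
  unfolding wdeg_def by (rule member_le_sum) auto

lemma wdeg_add: "wdeg (\<lambda>i j. V i j + U i j) i = wdeg V i + wdeg U i"
  by (simp add: wdeg_def sum.distrib)

lemma wdeg_mono: "(\<And>j. V i j \<le> U i j) \<Longrightarrow> wdeg V i \<le> wdeg U i"
  by (simp add: wdeg_def sum_mono)

lemma share_nonneg: "(\<And>i j. 0 \<le> V i j) \<Longrightarrow> 0 \<le> share V i j"
  by (simp add: share_def wdeg_nonneg)

lemma share_le_1: "(\<And>i j. 0 \<le> V i j) \<Longrightarrow> share V i j \<le> 1"
  using entry_le_wdeg[of V i j] wdeg_nonneg[of V i] by (auto simp: share_def divide_le_eq_1)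

lemma sum_share: "wdeg V i \<noteq> 0 \<Longrightarrow> (\<Sum>j\<in>UNIV. share V i j) = 1"
  by (simp add: share_def wdeg_def flip: sum_divide_distrib)

lemma rate_sym: "(\<And>i j. q i j = q j i) \<Longrightarrow> rate q V i j = rate q V j i"
  unfolding rate_def by (metis mult.assoc mult.commute)

lemma rate_nonneg: "(\<And>i j. 0 \<le> V i j) \<Longrightarrow> 0 \<le> q i j \<Longrightarrow> 0 \<le> rate q V i j"
  unfolding rate_def by (intro mult_nonneg_nonneg share_nonneg)

lemma rate_le_share: "(\<And>i j. 0 \<le> V i j) \<Longrightarrow> 0 \<le> q i j \<Longrightarrow> rate q V i j \<le> q i j * share V i j"
  using mult_left_le[OF share_le_1, of V "q i j * share V i j" j i]
  by (simp add: rate_def share_nonneg)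

lemma rate_le: "(\<And>i j. 0 \<le> V i j) \<Longrightarrow> 0 \<le> q i j \<Longrightarrow> rate q V i j \<le> q i j"
  using rate_le_share[of V q i j] mult_left_le[OF share_le_1, of V "q i j" i j] by simp

lemma share_add:
  fixes V U :: "'v::finite \<Rightarrow> 'v \<Rightarrow> real"
  assumes V: "\<And>i j. 0 \<le> V i j" and U: "\<And>i j. 0 \<le> U i j" and pos: "0 < wdeg V i"
  defines "W \<equiv> \<lambda>i j. V i j + U i j"
  shows "\<bar>share W i j - share V i j\<bar> \<le> wdeg U i / wdeg V i"
    and "\<bar>share W i j - share V i j - dshare V U i j\<bar> \<le> (wdeg U i / wdeg V i)\<^sup>2"
proof -
  let ?v = "wdeg V i" and ?u = "wdeg U i" and ?d = "U i j - share V i j * wdeg U i"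
  have u0: "0 \<le> ?u" by (simp add: wdeg_nonneg U)
  have s: "0 \<le> share V i j" "share V i j \<le> 1" by (simp_all add: share_nonneg share_le_1 V)
  have "share V i j * ?u \<le> 1 * ?u" by (intro mult_right_mono s u0)
  moreover have "0 \<le> share V i j * ?u" using s u0 by simp
  ultimately have d: "\<bar>?d\<bar> \<le> ?u"
    using U[of i j] entry_le_wdeg[of U i j, OF U] by linarith
  have rW: "wdeg W i = ?v + ?u" unfolding W_def by (rule wdeg_add)
  have Vs: "V i j = share V i j * ?v" using pos by (simp add: share_def)
  \<comment> \<open>The exact increment has denominator \<open>?v + ?u\<close>, the differential the
    same numerator over \<open>?v\<close>. The numerator is at most \<open>?u\<close>, and
    exchanging the denominators costs a further factor \<open>?u / (?v + ?u)\<close>; this gives the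
    two bounds.\<close>
  have eq: "share W i j - share V i j = ?d / (?v + ?u)"
  proof -
    have "share W i j = (share V i j * ?v + U i j) / (?v + ?u)"
      unfolding share_def[of W] rW Vs[symmetric] by (simp add: W_def)
    then show ?thesis using pos u0 by (simp add: field_simps)
  qed
  have "\<bar>?d / (?v + ?u)\<bar> \<le> ?u / ?v"
    using d pos u0 by (simp add: abs_divide) (intro frac_le, auto)
  then show "\<bar>share W i j - share V i j\<bar> \<le> ?u / ?v" by (simp add: eq)
  have "d / (v + u) - d / v = - (d / v) * (u / (v + u))" if "0 < v" "0 \<le> u" for d v u :: real
    using that by (simp add: field_simps)
  then have "share W i j - share V i j - dshare V U i j = - (?d / ?v) * (?u / (?v + ?u))"
    unfolding eq dshare_def using pos u0 by blast
  moreover have "\<bar>- (?d / ?v) * (?u / (?v + ?u))\<bar> \<le> (?u / ?v) * (?u / ?v)"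
    unfolding abs_mult
  proof (rule mult_mono)
    show "\<bar>- (?d / ?v)\<bar> \<le> ?u / ?v" using d pos by (simp add: abs_divide divide_right_mono)
    show "\<bar>?u / (?v + ?u)\<bar> \<le> ?u / ?v" using pos u0 by (simp add: abs_divide frac_le)
  qed (use pos u0 in auto)
  ultimately show "\<bar>share W i j - share V i j - dshare V U i j\<bar> \<le> (?u / ?v)\<^sup>2"
    by (simp add: power2_eq_square)
qed

lemma product_second_order:
  fixes x y x' y' dx dy a b :: real
  assumes "0 \<le> x" "x \<le> 1" "0 \<le> y" "y \<le> 1" "\<bar>x' - x\<bar> \<le> a" "\<bar>y' - y\<bar> \<le> b"
    and "\<bar>x' - x - dx\<bar> \<le> a\<^sup>2" "\<bar>y' - y - dy\<bar> \<le> b\<^sup>2"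
  shows "\<bar>x' * y' - x * y - (x * dy + y * dx)\<bar> \<le> 2 * (a\<^sup>2 + b\<^sup>2)"
proof -
  \<comment> \<open>Product rule with remainder: \<open>A\<close> and \<open>B\<close> carry the
    second order errors of the two factors, \<open>C\<close> is the mixed term.\<close>
  define A B C where "A = x * (y' - y - dy)" and "B = y * (x' - x - dx)" and "C = (x' - x) * (y' - y)"
  have eq: "x' * y' - x * y - (x * dy + y * dx) = A + B + C"
    by (simp add: A_def B_def C_def algebra_simps)
  have "\<bar>A\<bar> \<le> 1 * b\<^sup>2"
    unfolding abs_mult A_def using assms by (intro mult_mono) auto
  moreover have "\<bar>B\<bar> \<le> 1 * a\<^sup>2"
    unfolding abs_mult B_def using assms by (intro mult_mono) auto
  moreover have "\<bar>C\<bar> \<le> a * b"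
    unfolding abs_mult C_def using assms by (intro mult_mono) auto
  moreover have "a * b \<le> a\<^sup>2 + b\<^sup>2"
    using sum_squares_bound[of a b] zero_le_power2[of a] zero_le_power2[of b] by linarith
  ultimately have "\<bar>A\<bar> + \<bar>B\<bar> + \<bar>C\<bar> \<le> b\<^sup>2 + a\<^sup>2 + (a\<^sup>2 + b\<^sup>2)" by (intro add_mono) auto
  moreover have "\<bar>A + B + C\<bar> \<le> \<bar>A\<bar> + \<bar>B\<bar> + \<bar>C\<bar>" by linarith
  ultimately show ?thesis unfolding eq by simp
qed

lemma product_first_order:
  fixes x y x' y' a b :: real
  assumes "0 \<le> x" "x \<le> 1" "0 \<le> y'" "y' \<le> 1" "\<bar>x' - x\<bar> \<le> a" "\<bar>y' - y\<bar> \<le> b"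
  shows "\<bar>x' * y' - x * y\<bar> \<le> a + b"
proof -
  have "x' * y' - x * y = (x' - x) * y' + x * (y' - y)" by (simp add: algebra_simps)
  moreover have "\<bar>(x' - x) * y'\<bar> \<le> a * 1" unfolding abs_mult using assms by (intro mult_mono) auto
  moreover have "\<bar>x * (y' - y)\<bar> \<le> 1 * b" unfolding abs_mult using assms by (intro mult_mono) auto
  ultimately show ?thesis by linarith
qed

lemma rate_add:
  fixes V U :: "'v::finite \<Rightarrow> 'v \<Rightarrow> real"
  assumes V: "\<And>i j. 0 \<le> V i j" and U: "\<And>i j. 0 \<le> U i j"
    and q: "0 \<le> q i j" and pos: "q i j \<noteq> 0 \<Longrightarrow> 0 < wdeg V i" "q i j \<noteq> 0 \<Longrightarrow> 0 < wdeg V j"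
  defines "W \<equiv> \<lambda>i j. V i j + U i j"
  shows "\<bar>rate q W i j - rate q V i j\<bar> \<le> q i j * (wdeg U i / wdeg V i + wdeg U j / wdeg V j)"
    and "\<bar>rate q W i j - rate q V i j - drate q V U i j\<bar>
      \<le> 2 * q i j * ((wdeg U i / wdeg V i)\<^sup>2 + (wdeg U j / wdeg V j)\<^sup>2)"
proof -
  have W: "0 \<le> W i j" for i j using V U by (simp add: W_def)
  let ?a = "wdeg U i / wdeg V i" and ?b = "wdeg U j / wdeg V j"
  have "\<bar>rate q W i j - rate q V i j\<bar> \<le> q i j * (?a + ?b) \<and>
      \<bar>rate q W i j - rate q V i j - drate q V U i j\<bar> \<le> 2 * q i j * (?a\<^sup>2 + ?b\<^sup>2)"
  \<comment> \<open>Where \<open>q i j\<close> vanishes, the rates and the differential vanish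
    whatever the degrees are; elsewhere both degrees are positive.\<close>
  proof (cases "q i j = 0")
    case False
    note s = share_add[where j = j, OF V U pos(1)[OF False]] share_add[where j = i, OF V U pos(2)[OF False]]
    have e1: "rate q W i j - rate q V i j = q i j * (share W i j * share W j i - share V i j * share V j i)"
      by (simp add: rate_def algebra_simps)
    have e2: "rate q W i j - rate q V i j - drate q V U i j =
        q i j * (share W i j * share W j i - share V i j * share V j i
          - (share V i j * dshare V U j i + share V j i * dshare V U i j))"
      by (simp add: rate_def drate_def algebra_simps)
    have 1: "\<bar>share W i j * share W j i - share V i j * share V j i\<bar> \<le> ?a + ?b"
      unfolding W_def by (rule product_first_order)
        (use s W[unfolded W_def] V in \<open>auto simp: share_nonneg share_le_1\<close>)
    have 2: "\<bar>share W i j * share W j i - share V i j * share V j i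
          - (share V i j * dshare V U j i + share V j i * dshare V U i j)\<bar> \<le> 2 * (?a\<^sup>2 + ?b\<^sup>2)"
      unfolding W_def by (rule product_second_order)
        (use s V in \<open>auto simp: share_nonneg share_le_1\<close>)
    have "2 * q i j * (?a\<^sup>2 + ?b\<^sup>2) = q i j * (2 * (?a\<^sup>2 + ?b\<^sup>2))" by simp
    then show ?thesis
      using mult_left_mono[OF 1 q] mult_left_mono[OF 2 q] unfolding e2 unfolding e1 abs_mult
      by (simp only: abs_of_nonneg[OF q])
  qed (simp add: rate_def drate_def)
  then show "\<bar>rate q W i j - rate q V i j\<bar> \<le> q i j * (?a + ?b)"
    "\<bar>rate q W i j - rate q V i j - drate q V U i j\<bar> \<le> 2 * q i j * (?a\<^sup>2 + ?b\<^sup>2)" by auto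
qed

section \<open>The drift of the total rate as a sum of variances\<close>

definition dispersion :: "('v::finite \<Rightarrow> 'v \<Rightarrow> real) \<Rightarrow> ('v \<Rightarrow> 'v \<Rightarrow> real) \<Rightarrow> 'v \<Rightarrow> 'v \<Rightarrow> real" where
  "dispersion q V i j = share V i j * (q i j * share V j i - wdeg (rate q V) i)\<^sup>2 / wdeg V i"

lemma half_drate:
  "q i j * (share V j i * dshare V (rate q V) i j)
    = q i j * share V j i * share V i j * (q i j * share V j i - wdeg (rate q V) i) / wdeg V i"
  unfolding dshare_def rate_def by (simp add: right_diff_distrib mult_ac)

text \<open>Under the probability weights \<open>share V i j\<close> the quantity
  \<open>q i j * share V j i\<close> has mean \<open>wdeg (rate q V) i\<close>. The left side is the
  mean of this quantity times its centred version, hence its variance, divided by the degree;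
  \<open>dispersion\<close> is one term of that variance.\<close>

lemma sum_half_drate:
  "(\<Sum>j\<in>UNIV. q i j * (share V j i * dshare V (rate q V) i j)) = (\<Sum>j\<in>UNIV. dispersion q V i j)"
proof (cases "wdeg V i = 0")
  case False
  let ?s = "\<lambda>j. q i j * share V j i" and ?R = "wdeg (rate q V) i"
  have "(\<Sum>j\<in>UNIV. share V i j * (?s j - ?R)) = (\<Sum>j\<in>UNIV. rate q V i j) - ?R * (\<Sum>j\<in>UNIV. share V i j)"
    unfolding rate_def right_diff_distrib sum_subtractf sum_distrib_left
    by (intro arg_cong2[where f = "(-)"] sum.cong refl) (simp_all add: mult_ac)
  also have "\<dots> = 0" by (simp add: sum_share[OF False]) (simp add: wdeg_def)
  finally have zero: "(\<Sum>j\<in>UNIV. share V i j * (?s j - ?R)) = 0" .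
  have "(\<Sum>j\<in>UNIV. ?s j * share V i j * (?s j - ?R))
      = (\<Sum>j\<in>UNIV. share V i j * (?s j - ?R)\<^sup>2 + ?R * (share V i j * (?s j - ?R)))"
    by (intro sum.cong refl) (simp add: power2_eq_square algebra_simps)
  also have "\<dots> = (\<Sum>j\<in>UNIV. share V i j * (?s j - ?R)\<^sup>2)"
    by (simp only: sum.distrib zero mult_zero_right add_0_right flip: sum_distrib_left)
  finally show ?thesis
    unfolding half_drate dispersion_def by (simp only: flip: sum_divide_distrib)
qed (simp add: dispersion_def dshare_def)

text \<open>By symmetry both endpoints contribute equally. For nonnegative weights the result is
  nonnegative, so to first order the mean gains never decrease the total rate, which serves as a
  Lyapunov function.\<close>

lemma sum_drate:
  assumes "\<And>i j. q i j = q j i"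
  shows "(\<Sum>i\<in>UNIV. \<Sum>j\<in>UNIV. drate q V (rate q V) i j) = 2 * (\<Sum>i\<in>UNIV. \<Sum>j\<in>UNIV. dispersion q V i j)"
proof -
  let ?h = "\<lambda>i j. q i j * (share V j i * dshare V (rate q V) i j)"
  have "(\<Sum>i\<in>UNIV. \<Sum>j\<in>UNIV. drate q V (rate q V) i j) = (\<Sum>i\<in>UNIV. \<Sum>j\<in>UNIV. ?h j i) + (\<Sum>i\<in>UNIV. \<Sum>j\<in>UNIV. ?h i j)"
    unfolding drate_def distrib_left sum.distrib by (simp add: assms[of i j for i j])
  also have "(\<Sum>i\<in>UNIV. \<Sum>j\<in>UNIV. ?h j i) = (\<Sum>i\<in>UNIV. \<Sum>j\<in>UNIV. ?h i j)"
    by (rule sum.swap)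
  finally show ?thesis by (simp add: sum_half_drate)
qed

lemma dispersion_nonneg: "(\<And>i j. 0 \<le> V i j) \<Longrightarrow> 0 \<le> dispersion q V i j"
  by (simp add: dispersion_def share_nonneg wdeg_nonneg)

text \<open>Conversely, one term of the variance controls the drift of its edge: the square of
  \<open>share V i j * \<bar>?d\<bar> / ?v\<close> is
  \<open>share V i j * dispersion q V i j / ?v\<close>. Only the square root of the dispersion
  appears, which is later compensated by Cauchy-Schwarz over a window.\<close>

lemma half_drate_bound:
  assumes V: "\<And>i j. 0 \<le> V i j" and q: "0 \<le> q i j" and D: "dispersion q V i j \<le> D"
  shows "\<bar>q i j * (share V j i * dshare V (rate q V) i j)\<bar> \<le> q i j * sqrt (D / wdeg V i)"
proof -
  let ?d = "q i j * share V j i - wdeg (rate q V) i" and ?v = "wdeg V i"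
  have v: "0 \<le> ?v" by (simp add: wdeg_nonneg V)
  have s: "0 \<le> share V i j" "share V i j \<le> 1" "0 \<le> share V j i" "share V j i \<le> 1"
    by (simp_all add: share_nonneg share_le_1 V)
  have "(share V i j * \<bar>?d\<bar> / ?v)\<^sup>2 = share V i j * (dispersion q V i j / ?v)"
    by (simp add: dispersion_def power2_eq_square flip: abs_mult)
  also have "\<dots> \<le> 1 * (D / ?v)"
    using s v D dispersion_nonneg[of V q i j, OF V] by (intro mult_mono divide_right_mono) auto
  finally have "share V i j * \<bar>?d\<bar> / ?v \<le> sqrt (D / ?v)"
    by (intro real_le_rsqrt) simp
  moreover have "share V j i * (share V i j * \<bar>?d\<bar> / ?v) \<le> share V i j * \<bar>?d\<bar> / ?v"
    using s v by (intro mult_left_le_one_le) auto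
  ultimately have "q i j * (share V j i * (share V i j * \<bar>?d\<bar> / ?v)) \<le> q i j * sqrt (D / ?v)"
    using q by (intro mult_left_mono) auto
  moreover have "\<bar>q i j * (share V j i * dshare V (rate q V) i j)\<bar>
      = q i j * (share V j i * (share V i j * \<bar>?d\<bar> / ?v))"
    unfolding half_drate using q s v by (simp add: abs_mult)
  ultimately show ?thesis by simp
qed

lemma drate_bound:
  assumes V: "\<And>i j. 0 \<le> V i j" and q: "\<And>i j. 0 \<le> q i j" and sym: "\<And>i j. q i j = q j i"
  defines "D \<equiv> \<Sum>i\<in>UNIV. \<Sum>j\<in>UNIV. dispersion q V i j"
  shows "\<bar>drate q V (rate q V) i j\<bar> \<le> q i j * (sqrt (D / wdeg V i) + sqrt (D / wdeg V j))"
proof -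
  have le: "dispersion q V i j \<le> D" for i j
  proof -
    have "dispersion q V i j \<le> (\<Sum>j\<in>UNIV. dispersion q V i j)"
      by (rule member_le_sum) (auto intro: dispersion_nonneg V)
    also have "\<dots> \<le> D" unfolding D_def
      by (rule member_le_sum[of i UNIV "\<lambda>i. \<Sum>j\<in>UNIV. dispersion q V i j"]) (auto intro!: sum_nonneg dispersion_nonneg V)
    finally show ?thesis .
  qed
  have "drate q V (rate q V) i j = q j i * (share V i j * dshare V (rate q V) j i)
      + q i j * (share V j i * dshare V (rate q V) i j)"
    unfolding drate_def by (simp add: distrib_left sym[of j i])
  also have "\<bar>\<dots>\<bar> \<le> q j i * sqrt (D / wdeg V j) + q i j * sqrt (D / wdeg V i)"
    by (intro order_trans[OF abs_triangle_ineq] add_mono half_drate_bound V q le)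
  finally show ?thesis by (simp add: sym[of j i] algebra_simps)
qed

section \<open>Asymptotics of a single path\<close>

lemma convergent_increments_small:
  fixes f :: "nat \<Rightarrow> real"
  assumes "convergent f" "0 < e"
  shows "\<forall>\<^sub>F n in sequentially. \<forall>m\<ge>n. \<bar>f m - f n\<bar> \<le> e"
proof -
  obtain N where "\<And>m n. m \<ge> N \<Longrightarrow> n \<ge> N \<Longrightarrow> dist (f m) (f n) < e"
    using assms unfolding Cauchy_convergent_iff[symmetric] Cauchy_def by blast
  then show ?thesis
    unfolding eventually_sequentially dist_real_def by (meson less_imp_le order_trans)
qed

lemma sum_ivl_diff:
  fixes f :: "nat \<Rightarrow> real"
  assumes "n \<le> m"
  shows "(\<Sum>k\<in>{n..<m}. f k) = (\<Sum>k<m. f k) - (\<Sum>k<n. f k)"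
  using sum_diff_nat_ivl[of 0 n m f] assms by (simp add: lessThan_atLeast0)

text \<open>Kronecker's lemma for windows \<open>{n..<m}\<close>, uniformly in \<open>m\<close>:
  Abel summation against the factors \<open>Suc k\<close> expresses the sum through the increments
  of the convergent series after \<open>n\<close>.\<close>

lemma summation_by_parts_bound:
  fixes f :: "nat \<Rightarrow> real"
  assumes conv: "convergent (\<lambda>n. \<Sum>k<n. f k / real (Suc k))" and e: "0 < e"
  shows "\<forall>\<^sub>F n in sequentially. \<forall>m\<ge>n. \<bar>\<Sum>k\<in>{n..<m}. f k\<bar> \<le> e * real m"
proof -
  let ?Z = "\<lambda>n. \<Sum>k<n. f k / real (Suc k)"
  have "\<forall>\<^sub>F n in sequentially. \<forall>m\<ge>n. \<bar>?Z m - ?Z n\<bar> \<le> e / 2"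
    using convergent_increments_small[OF conv, of "e / 2"] e by simp
  then show ?thesis
  proof eventually_elim
    case (elim n)
    define W where "W k = ?Z k - ?Z n" for k
    have abel: "(\<Sum>k\<in>{n..<m}. f k) = real m * W m - (\<Sum>k\<in>{n..<m}. W k)" if "n \<le> m" for m
      using that
    proof (induction m rule: dec_induct)
      case base then show ?case by (simp add: W_def)
    next
      case (step m)
      have "f m = real (Suc m) * (W (Suc m) - W m)" by (simp add: W_def)
      with step show ?case by (simp add: algebra_simps)
    qed
    have Wb: "\<bar>W k\<bar> \<le> e / 2" if "n \<le> k" for k using elim that by (simp add: W_def)
    show ?case
    proof (intro allI impI)
      fix m assume nm: "n \<le> m"
      have "\<bar>\<Sum>k\<in>{n..<m}. W k\<bar> \<le> (\<Sum>k\<in>{n..<m}. e / 2)"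
        by (intro order_trans[OF sum_abs] sum_mono) (use Wb in auto)
      also have "\<dots> \<le> real m * (e / 2)"
        using e by (simp add: mult_right_mono)
      finally have "\<bar>\<Sum>k\<in>{n..<m}. W k\<bar> \<le> real m * (e / 2)" .
      moreover have "\<bar>real m * W m\<bar> \<le> real m * (e / 2)"
        using mult_left_mono[OF Wb[OF nm], of "real m"] by (simp add: abs_mult)
      ultimately have "\<bar>real m * W m - (\<Sum>k\<in>{n..<m}. W k)\<bar> \<le> real m * (e / 2) + real m * (e / 2)"
        by (intro order_trans[OF abs_triangle_ineq4] add_mono)
      then show "\<bar>\<Sum>k\<in>{n..<m}. f k\<bar> \<le> e * real m"
        unfolding abel[OF nm] by (simp add: mult.commute)
    qed
  qed
qed

lemma sum_sqrt_le:
  fixes f :: "nat \<Rightarrow> real"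
  assumes "finite I" "\<And>i. i \<in> I \<Longrightarrow> 0 \<le> f i"
  shows "(\<Sum>i\<in>I. sqrt (f i)) \<le> sqrt (real (card I) * (\<Sum>i\<in>I. f i))"
proof (rule real_le_rsqrt)
  have "(\<Sum>i\<in>I. sqrt (f i))\<^sup>2 \<le> (\<Sum>i\<in>I. (sqrt (f i))\<^sup>2) * real (card I)"
    by (rule sum_squared_le_sum_of_squares)
  also have "(\<Sum>i\<in>I. (sqrt (f i))\<^sup>2) = (\<Sum>i\<in>I. f i)"
    using assms by simp
  finally show "(\<Sum>i\<in>I. sqrt (f i))\<^sup>2 \<le> real (card I) * (\<Sum>i\<in>I. f i)"
    by (simp add: mult.commute)
qed

lemma double_member_le_sum:
  fixes f :: "'v::finite \<Rightarrow> 'v \<Rightarrow> real"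
  assumes "\<And>i j. 0 \<le> f i j"
  shows "f i j \<le> (\<Sum>i\<in>UNIV. \<Sum>j\<in>UNIV. f i j)"
proof -
  have "f i j \<le> (\<Sum>j\<in>UNIV. f i j)"
    by (rule member_le_sum) (auto simp: assms)
  also have "\<dots> \<le> (\<Sum>i\<in>UNIV. \<Sum>j\<in>UNIV. f i j)"
    by (rule member_le_sum[of i UNIV "\<lambda>i. \<Sum>j\<in>UNIV. f i j"]) (auto intro!: sum_nonneg assms)
  finally show ?thesis .
qed

text \<open>Pigeonhole: the bands between \<open>\<kappa> * \<kappa> ^ k\<close> and
  \<open>\<kappa> ^ k\<close> for \<open>k \<le> CARD('v)\<close> are disjoint and outnumber the
  vertices, so one of them contains no value of \<open>f\<close>.\<close>

lemma scale_gap: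
  fixes f :: "'v::finite \<Rightarrow> real"
  assumes \<kappa>: "0 < \<kappa>" "\<kappa> < 1"
  obtains k where "k \<le> CARD('v)" "\<And>i. f i \<le> \<kappa> * \<kappa> ^ k \<or> \<kappa> ^ k < f i"
proof -
  have "\<exists>k\<le>CARD('v). \<forall>i. f i \<le> \<kappa> * \<kappa> ^ k \<or> \<kappa> ^ k < f i"
  proof (rule ccontr)
    assume "\<not> ?thesis"
    then have "\<forall>k. \<exists>i. k \<le> CARD('v) \<longrightarrow> \<kappa> * \<kappa> ^ k < f i \<and> f i \<le> \<kappa> ^ k"
      by (meson not_le)
    then obtain g where g: "\<And>k. k \<le> CARD('v) \<Longrightarrow> \<kappa> * \<kappa> ^ k < f (g k) \<and> f (g k) \<le> \<kappa> ^ k"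
      by metis
    have neq: "g k \<noteq> g l" if "k < l" "l \<le> CARD('v)" for k l
    proof
      assume eq: "g k = g l"
      have "\<kappa> ^ l \<le> \<kappa> ^ Suc k" using that \<kappa> by (intro power_decreasing) auto
      with g[of k] g[of l] that eq show False by simp
    qed
    have "inj_on g {..CARD('v)}"
      by (rule linorder_inj_onI) (use neq in auto)
    then have "card {..CARD('v)} \<le> CARD('v)"
      using card_inj_on_le[of g "{..CARD('v)}" UNIV] by simp
    then show False by simp
  qed
  then show thesis using that by blast
qed

text \<open>What is used about a single trajectory. For the random process \<open>noise\<close>,
  which compares actual with mean gains, and \<open>drift\<close>, which compares rate increments
  with their differential along the mean gains, hold almost surely; the consequences are
  deterministic.\<close>

locale reinforced_path =
  fixes q :: "'v::finite \<Rightarrow> 'v \<Rightarrow> real" and V :: "nat \<Rightarrow> 'v \<Rightarrow> 'v \<Rightarrow> real" and A c :: real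
  assumes q_nonneg: "\<And>i j. 0 \<le> q i j" and q_sym: "\<And>i j. q i j = q j i"
    and V_nonneg: "\<And>n i j. 0 \<le> V n i j" and V_sym: "\<And>n i j. V n i j = V n j i"
    and V_incr: "\<And>n i j. V n i j \<le> V (Suc n) i j"
    and V_step: "\<And>n i j. V (Suc n) i j \<le> V n i j + A" and A: "1 \<le> A"
    and noise: "\<And>i j. convergent (\<lambda>n. \<Sum>k<n. (V (Suc k) i j - V k i j - rate q (V k) i j) / real (Suc k))"
    and drift: "\<And>i j. convergent (\<lambda>n. \<Sum>k<n. rate q (V (Suc k)) i j - rate q (V k) i j
                    - drate q (V k) (rate q (V k)) i j)"
    and c: "0 < c" and H_lower: "\<And>n. c \<le> (\<Sum>i\<in>UNIV. \<Sum>j\<in>UNIV. rate q (V n) i j)"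
begin

section \<open>Bounds for the rates and convergence of the total rate\<close>

abbreviation r :: "nat \<Rightarrow> 'v \<Rightarrow> 'v \<Rightarrow> real" where "r n \<equiv> rate q (V n)"
definition H :: "nat \<Rightarrow> real" where "H n = (\<Sum>i\<in>UNIV. \<Sum>j\<in>UNIV. r n i j)"
definition D :: "nat \<Rightarrow> real" where "D n = (\<Sum>i\<in>UNIV. \<Sum>j\<in>UNIV. dispersion q (V n) i j)"

definition Q :: real where "Q = 1 + (\<Sum>i\<in>UNIV. \<Sum>j\<in>UNIV. q i j)"

lemma q_le: "q i j \<le> Q"
  using double_member_le_sum[of q i j] q_nonneg by (simp add: Q_def)

lemma Q_pos: "0 < Q"
  by (simp add: Q_def add_pos_nonneg sum_nonneg q_nonneg)

lemma r_nonneg: "0 \<le> r n i j"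
  by (intro rate_nonneg V_nonneg q_nonneg)

lemma r_le: "r n i j \<le> Q"
  by (intro order_trans[OF rate_le q_le] V_nonneg q_nonneg)

lemma r_sym: "r n i j = r n j i"
  by (intro rate_sym q_sym)

lemma D_nonneg: "0 \<le> D n"
  unfolding D_def by (intro sum_nonneg dispersion_nonneg V_nonneg)

lemma H_bounds: "0 \<le> H n" "H n \<le> Q"
proof -
  show "0 \<le> H n" unfolding H_def by (intro sum_nonneg r_nonneg)
  have "H n \<le> (\<Sum>i\<in>UNIV. \<Sum>j\<in>UNIV. q i j)" unfolding H_def by (intro sum_mono rate_le V_nonneg q_nonneg)
  then show "H n \<le> Q" by (simp add: Q_def)
qed

lemma V_mono: "n \<le> m \<Longrightarrow> V n i j \<le> V m i j"
  by (rule lift_Suc_mono_le[of "\<lambda>n. V n i j"]) (auto intro: V_incr)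

lemma wdeg_V_mono: "n \<le> m \<Longrightarrow> wdeg (V n) i \<le> wdeg (V m) i"
  by (intro wdeg_mono V_mono)

lemma V_growth: "n \<le> m \<Longrightarrow> V m i j \<le> V n i j + A * real (m - n)"
proof (induction m rule: dec_induct)
  case (step m)
  then show ?case using V_step[of m i j] by (simp add: Suc_diff_le algebra_simps)
qed simp

lemma wdeg_growth: "n \<le> m \<Longrightarrow> wdeg (V m) i \<le> wdeg (V n) i + real CARD('v) * A * real (m - n)"
proof -
  assume nm: "n \<le> m"
  have "wdeg (V m) i \<le> (\<Sum>j\<in>UNIV. V n i j + A * real (m - n))"
    unfolding wdeg_def by (intro sum_mono V_growth nm)
  then show ?thesis by (simp add: wdeg_def sum.distrib mult_ac)
qed

lemma r_le_ratio: "r n i j \<le> Q * (V n i j / wdeg (V n) i)"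
proof -
  have "r n i j \<le> q i j * share (V n) i j" by (intro rate_le_share V_nonneg q_nonneg)
  also have "\<dots> \<le> Q * share (V n) i j" by (intro mult_right_mono q_le share_nonneg V_nonneg)
  finally show ?thesis by (simp add: share_def)
qed

definition E :: "'v \<Rightarrow> 'v \<Rightarrow> nat \<Rightarrow> real" where
  "E i j n = (\<Sum>k<n. r (Suc k) i j - r k i j - drate q (V k) (r k) i j)"

lemma E_convergent: "convergent (E i j)"
  using drift[of i j] by (simp add: E_def[abs_def])

lemma r_expand: "r n i j = r 0 i j + (\<Sum>k<n. drate q (V k) (r k) i j) + E i j n"
  by (induction n) (simp_all add: E_def)

lemma H_expand: "H n = H 0 + 2 * (\<Sum>k<n. D k) + (\<Sum>i\<in>UNIV. \<Sum>j\<in>UNIV. E i j n)"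
proof -
  have "H n = H 0 + (\<Sum>i\<in>UNIV. \<Sum>j\<in>UNIV. \<Sum>k<n. drate q (V k) (r k) i j) + (\<Sum>i\<in>UNIV. \<Sum>j\<in>UNIV. E i j n)"
    unfolding H_def sum.distrib[symmetric] by (intro sum.cong refl r_expand)
  also have "(\<Sum>i\<in>UNIV. \<Sum>j\<in>UNIV. \<Sum>k<n. drate q (V k) (r k) i j)
      = (\<Sum>k<n. \<Sum>i\<in>UNIV. \<Sum>j\<in>UNIV. drate q (V k) (r k) i j)"
    by (subst (2) sum.swap, subst sum.swap) (rule refl)
  also have "\<dots> = 2 * (\<Sum>k<n. D k)"
    by (simp only: sum_drate[OF q_sym] sum_distrib_left D_def)
  finally show ?thesis .
qed

lemma total_E_convergent: "convergent (\<lambda>n. \<Sum>i\<in>UNIV. \<Sum>j\<in>UNIV. E i j n)"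
  by (intro convergent_sum E_convergent)

text \<open>By \<open>H_expand\<close> twice a partial sum of \<open>D\<close> is an increment of
  \<open>H\<close> minus an increment of a convergent error. Both are bounded and \<open>D\<close>
  is nonnegative.\<close>

lemma D_summable: "summable D"
proof -
  obtain K where K: "\<And>n. \<bar>\<Sum>i\<in>UNIV. \<Sum>j\<in>UNIV. E i j n\<bar> \<le> K"
    using convergent_imp_Bseq[OF total_E_convergent] unfolding Bseq_def real_norm_def by blast
  show ?thesis
  proof (rule summableI_nonneg_bounded[OF D_nonneg])
    fix n show "(\<Sum>k<n. D k) \<le> (Q + K) / 2"
      using H_expand[of n] H_bounds(2)[of n] H_bounds(1)[of 0] abs_le_D2[OF K[of n]] by simp
  qed
qed

lemma H_convergent: "convergent H"
proof -
  have "convergent (\<lambda>n. H 0 + 2 * (\<Sum>k<n. D k) + (\<Sum>i\<in>UNIV. \<Sum>j\<in>UNIV. E i j n))"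
    using D_summable by (intro convergent_add convergent_mult convergent_const total_E_convergent)
      (simp add: summable_iff_convergent)
  then show ?thesis by (simp only: flip: H_expand)
qed

text \<open>On a window of length at most \<open>S * n\<close> with degrees at least
  \<open>\<eta> * n\<close>, the drift at time \<open>k\<close> is of order
  \<open>sqrt (D k / n)\<close>. By Cauchy-Schwarz the drifts add up to the order of the root of
  \<open>n\<close> times the sum of the \<open>D k / n\<close>; the factor \<open>n\<close> cancels
  and a tail of the convergent series of \<open>D\<close> remains.\<close>

lemma rate_slow_at_scale:
  assumes \<eta>: "0 < \<eta>" and S: "0 < S" and e: "0 < e"
  shows "\<forall>\<^sub>F n in sequentially. \<forall>m\<ge>n. real m \<le> S * real n \<longrightarrow>
    \<eta> * real n \<le> wdeg (V n) i \<longrightarrow> \<eta> * real n \<le> wdeg (V n) j \<longrightarrow> \<bar>r m i j - r n i j\<bar> \<le> e"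
proof -
  \<comment> \<open>Chosen so that \<open>2 * Q * sqrt (S * \<tau> / \<eta>)\<close> is exactly
    \<open>e / 2\<close>.\<close>
  define \<tau> where "\<tau> = \<eta> / S * (e / (4 * Q))\<^sup>2"
  have \<tau>: "0 < \<tau>" using \<eta> S e Q_pos by (simp add: \<tau>_def)
  have "convergent (\<lambda>n. \<Sum>k<n. D k)" using D_summable by (simp add: summable_iff_convergent)
  from convergent_increments_small[OF this \<tau>]
  have ev1: "\<forall>\<^sub>F n in sequentially. \<forall>m\<ge>n. \<bar>(\<Sum>k<m. D k) - (\<Sum>k<n. D k)\<bar> \<le> \<tau>" .
  have ev2: "\<forall>\<^sub>F n in sequentially. \<forall>m\<ge>n. \<bar>E i j m - E i j n\<bar> \<le> e / 2"
    using convergent_increments_small[OF E_convergent, of "e / 2" i j] e by simp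
  from ev1 ev2 eventually_gt_at_top[of 0] show ?thesis
  proof eventually_elim
    case (elim n)
    show ?case
    proof (intro allI impI)
      fix m assume nm: "n \<le> m" and mS: "real m \<le> S * real n"
        and i: "\<eta> * real n \<le> wdeg (V n) i" and j: "\<eta> * real n \<le> wdeg (V n) j"
      let ?y = "\<eta> * real n" and ?I = "{n..<m}"
      have y: "0 < ?y" using \<eta> elim(3) by simp
      have "\<bar>drate q (V k) (r k) i j\<bar> \<le> 2 * Q * sqrt (D k / ?y)" if "k \<in> ?I" for k
      proof -
        have le: "sqrt (D k / wdeg (V k) l) \<le> sqrt (D k / ?y)" if "?y \<le> wdeg (V n) l" for l
        proof -
          have "?y \<le> wdeg (V k) l" using wdeg_V_mono[of n k l] that \<open>k \<in> ?I\<close> by auto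
          then show ?thesis using y D_nonneg[of k] by (intro real_sqrt_le_mono divide_left_mono) auto
        qed
        have "\<bar>drate q (V k) (r k) i j\<bar> \<le> q i j * (sqrt (D k / wdeg (V k) i) + sqrt (D k / wdeg (V k) j))"
          unfolding D_def by (intro drate_bound V_nonneg q_nonneg q_sym)
        also have "\<dots> \<le> Q * (sqrt (D k / ?y) + sqrt (D k / ?y))"
          using q_le q_nonneg Q_pos D_nonneg[of k] V_nonneg
          by (intro mult_mono add_mono le i j) (auto simp: wdeg_nonneg)
        finally show ?thesis by simp
      qed
      then have "\<bar>\<Sum>k\<in>?I. drate q (V k) (r k) i j\<bar> \<le> (\<Sum>k\<in>?I. 2 * Q * sqrt (D k / ?y))"
        by (intro order_trans[OF sum_abs] sum_mono)
      also have "\<dots> = 2 * Q * (\<Sum>k\<in>?I. sqrt (D k / ?y))" by (simp only: sum_distrib_left)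
      also have "\<dots> \<le> 2 * Q * sqrt (real (card ?I) * (\<Sum>k\<in>?I. D k / ?y))"
        by (intro mult_left_mono sum_sqrt_le divide_nonneg_pos D_nonneg y) (use Q_pos in auto)
      also have "real (card ?I) * (\<Sum>k\<in>?I. D k / ?y) \<le> (S * real n) * (\<tau> / ?y)"
      proof (rule mult_mono)
        show "real (card ?I) \<le> S * real n" using mS by simp
        have "(\<Sum>k\<in>?I. D k) \<le> \<tau>" using elim(1) nm by (simp add: sum_ivl_diff[OF nm] abs_le_iff)
        then show "(\<Sum>k\<in>?I. D k / ?y) \<le> \<tau> / ?y"
          using y by (simp add: divide_right_mono flip: sum_divide_distrib)
        show "0 \<le> (\<Sum>k\<in>?I. D k / ?y)" using y D_nonneg by (intro sum_nonneg divide_nonneg_pos)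
      qed (use S in simp)
      also have "(S * real n) * (\<tau> / ?y) = (e / (4 * Q))\<^sup>2"
        using S \<eta> elim(3) by (simp add: \<tau>_def)
      finally have d: "\<bar>\<Sum>k\<in>?I. drate q (V k) (r k) i j\<bar> \<le> e / 2"
        using Q_pos e by simp
      have "r m i j - r n i j = (\<Sum>k\<in>?I. drate q (V k) (r k) i j) + (E i j m - E i j n)"
        unfolding r_expand[of m] r_expand[of n] sum_ivl_diff[OF nm] by simp
      moreover have "\<bar>E i j m - E i j n\<bar> \<le> e / 2" using elim(2) nm by blast
      ultimately show "\<bar>r m i j - r n i j\<bar> \<le> e" using d by linarith
    qed
  qed
qed

lemma V_increment:
  assumes "0 < e"
  shows "\<forall>\<^sub>F n in sequentially. \<forall>m\<ge>n. \<bar>V m i j - V n i j - (\<Sum>k\<in>{n..<m}. r k i j)\<bar> \<le> e * real m"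
  using summation_by_parts_bound[OF noise[of i j] assms]
proof eventually_elim
  case (elim n)
  have "(\<Sum>k\<in>{n..<m}. V (Suc k) i j - V k i j - r k i j) = V m i j - V n i j - (\<Sum>k\<in>{n..<m}. r k i j)"
    if "n \<le> m" for m
    using sum_Suc_diff'[OF that, of "\<lambda>k. V k i j"] by (simp add: sum_subtractf)
  with elim show ?case by simp
qed

text \<open>At a gap between the scales of the degrees, the vertices above the gap have slowly varying
  rates and the rates across the gap are negligible. As \<open>H\<close> converges, the total rate below the
  gap is then slowly varying as well, so it must be small, since these vertices have gathered little weight.\<close>
lemma small_degree:
  assumes \<delta>: "0 < \<delta>"
  shows "\<exists>\<eta>>0. \<forall>\<^sub>F n in sequentially. \<forall>i. wdeg (V n) i \<le> \<eta> * real n \<longrightarrow> wdeg (r n) i \<le> \<delta>"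
proof -
  define N where "N = real CARD('v)"
  have N: "1 \<le> N" by (simp add: N_def Suc_leI)
  \<comment> \<open>The final estimate is \<open>G * \<epsilon> + B * \<kappa>\<close>. The ratio
    \<open>\<kappa>\<close> of the gap is fixed first, then the precision \<open>\<epsilon>\<close>,
    each making its product at most \<open>\<delta> / 2\<close>.\<close>
  define B where "B = 2 * N\<^sup>2 * Q + 4 * N\<^sup>2 * A + 2 * N * Q"
  have B: "0 < B" unfolding B_def using N A Q_pos by (intro add_pos_pos mult_pos_pos) auto
  define \<kappa> where "\<kappa> = min (1 / 2) (\<delta> / (2 * B))"
  have \<kappa>: "0 < \<kappa>" "\<kappa> < 1" using \<delta> B by (auto simp: \<kappa>_def)
  have B\<kappa>: "B * \<kappa> \<le> \<delta> / 2"
    using mult_left_mono[of \<kappa> "\<delta> / (2 * B)" B] B by (simp add: \<kappa>_def)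
  \<comment> \<open>A lower bound for every threshold \<open>\<kappa> ^ k\<close> that
    \<open>scale_gap\<close> can return, so that the constants do not depend on
    \<open>n\<close>.\<close>
  define \<theta>0 where "\<theta>0 = \<kappa> ^ CARD('v)"
  have \<theta>0: "0 < \<theta>0" using \<kappa> by (simp add: \<theta>0_def)
  define G where "G = 1 + N\<^sup>2 + 4 * N ^ 3 * A / \<theta>0"
  have G: "0 < G" unfolding G_def using N A \<theta>0 by (intro add_pos_nonneg divide_nonneg_pos) auto
  define \<epsilon> where "\<epsilon> = \<delta> / (2 * G)"
  have \<epsilon>: "0 < \<epsilon>" "G * \<epsilon> = \<delta> / 2" using \<delta> G by (auto simp: \<epsilon>_def)
  define P1 where "P1 n \<longleftrightarrow> (\<forall>i j. \<forall>m\<ge>n. real m \<le> 2 * real n \<longrightarrow> \<theta>0 / 2 * real n \<le> wdeg (V n) i \<longrightarrow>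
      \<theta>0 / 2 * real n \<le> wdeg (V n) j \<longrightarrow> \<bar>r m i j - r n i j\<bar> \<le> \<epsilon>)" for n
  define P2 where "P2 n \<longleftrightarrow> (\<forall>m\<ge>n. \<bar>H m - H n\<bar> \<le> \<epsilon>)" for n
  define P3 where "P3 n \<longleftrightarrow> (\<forall>i j. \<forall>m\<ge>n. \<bar>V m i j - V n i j - (\<Sum>k\<in>{n..<m}. r k i j)\<bar> \<le> \<epsilon> * real m)" for n
  have "eventually P1 sequentially"
    unfolding P1_def using \<theta>0 \<epsilon>(1) by (intro eventually_all_finite rate_slow_at_scale) auto
  moreover have "eventually P2 sequentially"
    unfolding P2_def by (rule convergent_increments_small[OF H_convergent \<epsilon>(1)])
  moreover have "eventually P3 sequentially"
    unfolding P3_def using \<epsilon>(1) by (intro eventually_all_finite V_increment)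
  ultimately have "\<forall>\<^sub>F n in sequentially. P1 n \<and> P2 n \<and> P3 n" by (intro eventually_conj)
  then obtain n1 where n1: "\<And>n. n1 \<le> n \<Longrightarrow> P1 n" "\<And>n. n1 \<le> n \<Longrightarrow> P2 n" "\<And>n. n1 \<le> n \<Longrightarrow> P3 n"
    unfolding eventually_sequentially by blast
  note n1 = n1(1)[unfolded P1_def, rule_format] n1(2)[unfolded P2_def, rule_format] n1(3)[unfolded P3_def, rule_format]
  have main: "wdeg (r n) i \<le> \<delta>"
    if n: "2 * n1 \<le> n" "4 * N * A / \<theta>0 \<le> real n" and i: "wdeg (V n) i \<le> \<kappa> * \<theta>0 * real n" for n i
  proof -
    have n_pos: "0 < real n"
    proof -
      have "0 < 4 * N * A / \<theta>0" using N A \<theta>0 by simp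
      with n(2) show ?thesis by linarith
    qed
    obtain k where k: "k \<le> CARD('v)"
      "\<And>i. wdeg (V n) i / real n \<le> \<kappa> * \<kappa> ^ k \<or> \<kappa> ^ k < wdeg (V n) i / real n"
      using scale_gap[OF \<kappa>, of "\<lambda>i. wdeg (V n) i / real n"] by blast
    define \<theta> where "\<theta> = \<kappa> ^ k"
    have \<theta>: "\<theta>0 \<le> \<theta>" "\<theta> \<le> 1"
      using \<kappa> k(1) by (auto simp: \<theta>_def \<theta>0_def power_le_one intro: power_decreasing)
    have \<theta>_pos: "0 < \<theta>" using \<theta> \<theta>0 by simp
    \<comment> \<open>\<open>T\<close> consists of the vertices below the gap; by the choice of
      \<open>k\<close> all others have degree above \<open>\<theta> * n\<close>.\<close>
    define T where "T = {i. wdeg (V n) i \<le> \<kappa> * \<theta> * real n}"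
    have big: "\<theta> * real n \<le> wdeg (V n) j" if "j \<notin> T" for j
      using k(2)[of j] that n_pos by (simp add: T_def \<theta>_def field_simps)
    have iT: "i \<in> T"
    proof -
      have "\<kappa> * \<theta>0 * real n \<le> \<kappa> * \<theta> * real n"
        using \<theta> \<kappa> by (intro mult_right_mono mult_left_mono) auto
      with i show ?thesis by (simp add: T_def)
    qed
    \<comment> \<open>A degree grows by at most \<open>N * A\<close> per step. Going back
      \<open>s * n\<close> steps, a vertex outside \<open>T\<close> therefore loses at most half of
      \<open>\<theta> * n\<close>.\<close>
    define s where "s = \<theta> / (2 * N * A)"
    have NA: "1 \<le> N * A" using mult_mono[OF N A] N by simp
    have s: "0 < s" "s \<le> 1 / 2"
      using \<theta> \<theta>_pos NA by (auto simp: s_def divide_le_eq mult.assoc)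
    have "4 * N * A \<le> real n * \<theta>0" using n(2) \<theta>0 by (simp add: divide_le_eq)
    also have "\<dots> \<le> real n * \<theta>" using \<theta> by (intro mult_left_mono) auto
    finally have "4 * N * A \<le> \<theta> * real n" by (simp add: mult.commute)
    then have sn: "2 \<le> s * real n"
      using N A by (simp add: s_def le_divide_eq mult_ac)
    \<comment> \<open>Since \<open>s * n\<close> is at least 2, rounding down costs at most a factor
      two. Since \<open>s\<close> is at most one half, the window starts no earlier than
      \<open>n / 2\<close>, as \<open>P1\<close> requires.\<close>
    define n0 where "n0 = nat \<lfloor>s * real n\<rfloor>"
    have n0: "real n0 \<le> s * real n" "s * real n / 2 \<le> real n0"
      using sn unfolding n0_def by linarith+
    have half: "s * real n \<le> real n / 2" using mult_right_mono[OF s(2), of "real n"] by simp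
    define m0 where "m0 = n - n0"
    have m0: "m0 \<le> n" "n1 \<le> m0" "real n \<le> 2 * real m0" "real n - real m0 = real n0"
      using n0 half n(1) unfolding m0_def by linarith+
    have low: "\<theta> * real n / 2 \<le> wdeg (V m) j" if "j \<notin> T" "m0 \<le> m" "m \<le> n" for m j
    proof -
      have "N * A * real (n - m) \<le> N * A * (s * real n)"
        using that m0 n0 NA by (intro mult_left_mono) auto
      also have "\<dots> = \<theta> * real n / 2" using N A by (simp add: s_def)
      finally show ?thesis using wdeg_growth[OF that(3), of j] big[OF that(1)] by (simp add: N_def)
    qed
    \<comment> \<open>The weight of an edge across the gap is at most the degree of its end in
      \<open>T\<close>, which by monotonicity is at most \<open>\<kappa> * \<theta> * n\<close> on
      the whole window, while the other end has degree at least
      \<open>\<theta> * n / 2\<close>.\<close>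
    have cross: "r m a b \<le> 2 * Q * \<kappa>" if ab: "a \<in> T \<longleftrightarrow> b \<notin> T" and m: "m0 \<le> m" "m \<le> n" for m a b
    proof -
      have cr: "r m a b \<le> 2 * Q * \<kappa>" if "a \<notin> T" "b \<in> T" for a b
      proof -
        have "V m a b \<le> wdeg (V m) b"
          unfolding V_sym[of m a b] by (intro entry_le_wdeg V_nonneg)
        also have "\<dots> \<le> \<kappa> * \<theta> * real n" using wdeg_V_mono[OF m(2), of b] that(2) by (simp add: T_def)
        finally have "V m a b / wdeg (V m) a \<le> (\<kappa> * \<theta> * real n) / (\<theta> * real n / 2)"
          using low[OF that(1) m] \<theta>_pos n_pos \<kappa> by (intro frac_le) auto
        also have "\<dots> = 2 * \<kappa>" using \<theta>_pos n_pos by simp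
        finally have "Q * (V m a b / wdeg (V m) a) \<le> Q * (2 * \<kappa>)" using Q_pos by (intro mult_left_mono) auto
        then show ?thesis using r_le_ratio[of m a b] by simp
      qed
      show ?thesis using ab cr[of a b] cr[of b a] r_sym[of m a b] by auto
    qed
    have slow: "r m a b - r n a b \<le> \<epsilon>" if "a \<notin> T" "b \<notin> T" and m: "m0 \<le> m" "m \<le> n" for m a b
    proof -
      have le: "\<theta>0 / 2 * real m \<le> wdeg (V m) j" if "j \<notin> T" for j
      proof -
        have "\<theta>0 * real m \<le> \<theta> * real n" using \<theta> \<theta>0 m by (intro mult_mono) auto
        then show ?thesis using low[OF that m] by simp
      qed
      have "\<bar>r n a b - r m a b\<bar> \<le> \<epsilon>"
        by (rule n1(1)) (use m m0 le that in auto)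
      then show ?thesis by simp
    qed
    define HT where "HT m = (\<Sum>a\<in>UNIV. \<Sum>b\<in>UNIV. if a \<in> T \<and> b \<in> T then r m a b else 0)" for m
    define e1 where "e1 = \<epsilon> + N\<^sup>2 * (\<epsilon> + 2 * Q * \<kappa>)"
    \<comment> \<open>A rate not inside \<open>T\<close> exceeds its value at time \<open>n\<close>
      by at most \<open>\<epsilon> + 2 * Q * \<kappa>\<close> earlier in the window, and
      \<open>H\<close> moves by at most \<open>\<epsilon>\<close>. Hence the total rate inside
      \<open>T\<close> cannot have been much smaller before.\<close>
    have HT_slow: "HT n - e1 \<le> HT m" if m: "m0 \<le> m" "m \<le> n" for m
    proof -
      have "HT n - HT m = (\<Sum>a\<in>UNIV. \<Sum>b\<in>UNIV.
          (if a \<in> T \<and> b \<in> T then r n a b else 0) - (if a \<in> T \<and> b \<in> T then r m a b else 0))"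
        by (simp only: HT_def sum_subtractf)
      also have "\<dots> \<le> (\<Sum>a\<in>UNIV. \<Sum>b\<in>UNIV. (r n a b - r m a b) + (\<epsilon> + 2 * Q * \<kappa>))"
      proof (intro sum_mono)
        fix a b
        have "r m a b - r n a b \<le> \<epsilon> + 2 * Q * \<kappa>" if "\<not> (a \<in> T \<and> b \<in> T)"
        proof (cases "a \<in> T \<or> b \<in> T")
          case True
          with that have "a \<in> T \<longleftrightarrow> b \<notin> T" by blast
          from cross[OF this m] show ?thesis using r_nonneg[of n a b] \<epsilon>(1) by linarith
        next
          case False
          have "0 \<le> 2 * Q * \<kappa>" using Q_pos \<kappa> by simp
          moreover have "r m a b - r n a b \<le> \<epsilon>" using slow[OF _ _ m, of a b] False by auto
          ultimately show ?thesis by linarith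
        qed
        moreover have "0 \<le> \<epsilon> + 2 * Q * \<kappa>" using \<epsilon>(1) Q_pos \<kappa> by simp
        ultimately show "(if a \<in> T \<and> b \<in> T then r n a b else 0) - (if a \<in> T \<and> b \<in> T then r m a b else 0)
            \<le> (r n a b - r m a b) + (\<epsilon> + 2 * Q * \<kappa>)"
          by (cases "a \<in> T \<and> b \<in> T") auto
      qed
      also have "\<dots> = (H n - H m) + N\<^sup>2 * (\<epsilon> + 2 * Q * \<kappa>)"
        by (simp add: sum.distrib sum_subtractf N_def H_def power2_eq_square)
      also have "H n - H m \<le> \<epsilon>" using n1(2)[of m n] m m0 by auto
      finally show ?thesis by (simp add: e1_def)
    qed
    \<comment> \<open>Up to noise, the rates summed over the window are the weight gained in it,
      which is at most the weight at time \<open>n\<close>.\<close>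
    have VT: "(\<Sum>m\<in>{m0..<n}. if a \<in> T \<and> b \<in> T then r m a b else 0)
        \<le> (if a \<in> T then V n a b else 0) + \<epsilon> * real n" for a b
      using n1(3)[OF m0(2) m0(1), of a b] V_nonneg[of m0 a b] V_nonneg[of n a b] \<epsilon>(1)
      by (cases "a \<in> T \<and> b \<in> T") (auto simp: abs_le_iff)
    \<comment> \<open>The length of the window times the rate inside \<open>T\<close> is thus
      bounded by the weight that \<open>T\<close> holds at time \<open>n\<close>, which is of order
      \<open>\<kappa> * \<theta> * n\<close>, plus noise.\<close>
    have "real n0 * (HT n - e1) = (\<Sum>m\<in>{m0..<n}. HT n - e1)"
      using m0 by (simp add: of_nat_diff)
    also have "\<dots> \<le> (\<Sum>m\<in>{m0..<n}. HT m)" by (intro sum_mono HT_slow) auto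
    also have "\<dots> = (\<Sum>a\<in>UNIV. \<Sum>b\<in>UNIV. \<Sum>m\<in>{m0..<n}. if a \<in> T \<and> b \<in> T then r m a b else 0)"
      by (simp only: HT_def sum.swap[where A = "{m0..<n}"])
    also have "\<dots> \<le> (\<Sum>a\<in>UNIV. \<Sum>b\<in>UNIV. (if a \<in> T then V n a b else 0) + \<epsilon> * real n)"
      by (intro sum_mono VT)
    also have "\<dots> = (\<Sum>a\<in>UNIV. if a \<in> T then wdeg (V n) a else 0) + N\<^sup>2 * \<epsilon> * real n"
    proof -
      have "(\<Sum>b\<in>UNIV. if a \<in> T then V n a b else 0) = (if a \<in> T then wdeg (V n) a else 0)" for a
        by (simp add: wdeg_def)
      then show ?thesis by (simp add: sum.distrib N_def power2_eq_square)
    qed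
    also have "(\<Sum>a\<in>UNIV. if a \<in> T then wdeg (V n) a else 0) \<le> (\<Sum>a\<in>(UNIV :: 'v set). \<kappa> * \<theta> * real n)"
      using \<kappa> \<theta>_pos by (intro sum_mono) (auto simp: T_def)
    also have "\<dots> = N * \<kappa> * \<theta> * real n" by (simp add: N_def)
    finally have gain: "real n0 * (HT n - e1) \<le> (N * \<kappa> * \<theta> + N\<^sup>2 * \<epsilon>) * real n"
      by (simp add: distrib_right)
    \<comment> \<open>The bound in \<open>gain\<close> divided by \<open>s * n / 2\<close>. The
      factor \<open>\<theta> / \<theta>0\<close>, at least one, is inserted in the
      \<open>\<epsilon>\<close> term to make the quotient independent of
      \<open>\<theta>\<close>.\<close>
    define X where "X = 4 * N\<^sup>2 * A * \<kappa> + 4 * N ^ 3 * A * \<epsilon> / \<theta>0"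
    have X: "0 \<le> X" unfolding X_def using N A \<kappa> \<epsilon>(1) \<theta>0 by simp
    have HT: "HT n - e1 \<le> X"
    proof (rule ccontr)
      assume "\<not> HT n - e1 \<le> X"
      then have "(s * real n / 2) * X < (s * real n / 2) * (HT n - e1)"
        using s n_pos by (intro mult_strict_left_mono) auto
      also have "\<dots> \<le> real n0 * (HT n - e1)"
        using n0 X \<open>\<not> HT n - e1 \<le> X\<close> by (intro mult_right_mono) auto
      also note gain
      also have "(N * \<kappa> * \<theta> + N\<^sup>2 * \<epsilon>) * real n \<le> (N * \<kappa> * \<theta> + N\<^sup>2 * \<epsilon> * (\<theta> / \<theta>0)) * real n"
        using \<theta> \<theta>0 \<kappa> N \<epsilon>(1) mult_left_mono[of 1 "\<theta> / \<theta>0" "N\<^sup>2 * \<epsilon>"]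
        by (intro mult_right_mono add_mono) auto
      also have "\<dots> = (s * real n / 2) * X"
        using N A \<theta>0 by (simp add: s_def X_def field_simps power2_eq_square power3_eq_cube)
      finally show False by simp
    qed
    have "wdeg (r n) i \<le> (\<Sum>b\<in>UNIV. (if i \<in> T \<and> b \<in> T then r n i b else 0) + 2 * Q * \<kappa>)"
      unfolding wdeg_def
    proof (intro sum_mono)
      fix b show "r n i b \<le> (if i \<in> T \<and> b \<in> T then r n i b else 0) + 2 * Q * \<kappa>"
        using iT cross[OF _ m0(1), of i b] Q_pos \<kappa> by (cases "b \<in> T") auto
    qed
    also have "\<dots> = (\<Sum>b\<in>UNIV. if i \<in> T \<and> b \<in> T then r n i b else 0) + N * (2 * Q * \<kappa>)"
      by (simp add: sum.distrib N_def)
    also have "(\<Sum>b\<in>UNIV. if i \<in> T \<and> b \<in> T then r n i b else 0) \<le> HT n"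
      unfolding HT_def
      by (rule member_le_sum[of i UNIV "\<lambda>a. \<Sum>b\<in>UNIV. if a \<in> T \<and> b \<in> T then r n a b else 0"])
         (auto intro!: sum_nonneg simp: r_nonneg)
    also have "HT n \<le> e1 + X" using HT by simp
    also have "e1 + X + N * (2 * Q * \<kappa>) = G * \<epsilon> + B * \<kappa>"
      by (simp add: e1_def X_def G_def B_def algebra_simps)
    also have "\<dots> \<le> \<delta>" using \<epsilon>(2) B\<kappa> by simp
    finally show ?thesis by simp
  qed
  have "\<forall>\<^sub>F n in sequentially. 2 * n1 \<le> n" by (rule eventually_ge_at_top)
  moreover have "\<forall>\<^sub>F n in sequentially. 4 * N * A / \<theta>0 \<le> real n"
    using filterlim_real_sequentially by (simp add: filterlim_at_top)
  ultimately have "\<forall>\<^sub>F n in sequentially. \<forall>i. wdeg (V n) i \<le> \<kappa> * \<theta>0 * real n \<longrightarrow> wdeg (r n) i \<le> \<delta>"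
    by eventually_elim (use main in blast)
  moreover have "0 < \<kappa> * \<theta>0" using \<kappa> \<theta>0 by simp
  ultimately show ?thesis by blast
qed

text \<open>With both degrees large at time \<open>n\<close>, \<open>rate_slow_at_scale\<close>
  applies directly. Otherwise the rate at \<open>n\<close> is small, and so it suffices to see that
  the rate at \<open>m\<close> is small too: either no time up to \<open>m\<close> has both degrees
  large, or the comparison is started just before the first such time.\<close>

lemma rate_slow:
  assumes S: "1 \<le> S" and e: "0 < e"
  shows "\<forall>\<^sub>F n in sequentially. \<forall>m\<ge>n. real m \<le> S * real n \<longrightarrow> \<bar>r m i j - r n i j\<bar> \<le> e"
proof -
  obtain \<eta> where \<eta>: "0 < \<eta>"
    and small: "\<forall>\<^sub>F n in sequentially. \<forall>i. wdeg (V n) i \<le> \<eta> * real n \<longrightarrow> wdeg (r n) i \<le> e / 2"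
    using small_degree[of "e / 2"] e by auto
  define P where "P n \<longleftrightarrow> (\<forall>m\<ge>n. real m \<le> S * real n \<longrightarrow> \<eta> / 2 * real n \<le> wdeg (V n) i \<longrightarrow>
      \<eta> / 2 * real n \<le> wdeg (V n) j \<longrightarrow> \<bar>r m i j - r n i j\<bar> \<le> e / 2)" for n
  have "eventually P sequentially"
    unfolding P_def using \<eta> S e by (intro rate_slow_at_scale) auto
  from eventually_conj[OF small this] obtain n1 where
    small: "\<And>n i. n1 \<le> n \<Longrightarrow> wdeg (V n) i \<le> \<eta> * real n \<Longrightarrow> wdeg (r n) i \<le> e / 2"
    and "\<And>n. n1 \<le> n \<Longrightarrow> P n"
    unfolding eventually_sequentially by blast
  note slow = this(2)[unfolded P_def, rule_format]
  have low: "r n i j \<le> e / 2"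
    if "n1 \<le> n" "wdeg (V n) i \<le> \<eta> * real n \<or> wdeg (V n) j \<le> \<eta> * real n" for n
  proof -
    have "r n i j \<le> wdeg (r n) i" "r n j i \<le> wdeg (r n) j"
      by (intro entry_le_wdeg r_nonneg)+
    then show ?thesis using small[OF that(1), of i] small[OF that(1), of j] that(2) r_sym[of n i j] by auto
  qed
  have main: "\<bar>r m i j - r n i j\<bar> \<le> e"
    if n: "n1 \<le> n" "2 * real CARD('v) * A / \<eta> \<le> real n" and m: "n \<le> m" "real m \<le> S * real n" for n m
  proof -
    let ?big = "\<lambda>k. \<eta> * real k < wdeg (V k) i \<and> \<eta> * real k < wdeg (V k) j"
    show ?thesis
    proof (cases "?big n")
      case True
      have "\<eta> / 2 * real n \<le> \<eta> * real n" using \<eta> by simp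
      with True slow[OF n(1) m] e show ?thesis by fastforce
    next
      case False
      then have rn: "r n i j \<le> e / 2" using low[OF n(1)] by (auto simp: not_less)
      have "r m i j \<le> e"
      proof (cases "\<exists>k\<ge>n. k \<le> m \<and> ?big k")
        case False
        with m have "\<not> ?big m" by blast
        with low[of m] n m e show ?thesis by (auto simp: not_less)
      next
        case True
        \<comment> \<open>At the time \<open>l\<close> before the first time \<open>k\<close> with
          both degrees large the rate is still small. Because one step adds only a bounded amount,
          both degrees at \<open>l\<close> already exceed half the scale, so the rate stays close to
          its value at \<open>l\<close> up to time \<open>m\<close>.\<close>
        define k where "k = (LEAST k. n \<le> k \<and> k \<le> m \<and> ?big k)"
        have k: "n \<le> k" "k \<le> m" "?big k"
          using LeastI_ex[of "\<lambda>k. n \<le> k \<and> k \<le> m \<and> ?big k"] True unfolding k_def by blast+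
        have "k \<noteq> n" using k(3) \<open>\<not> ?big n\<close> by blast
        then obtain l where l: "k = Suc l" "n \<le> l" using k(1) by (cases k) auto
        have "\<not> ?big l"
        proof
          assume "?big l"
          then have "k \<le> l" unfolding k_def using l k by (intro Least_le) auto
          then show False using l by simp
        qed
        then have rl: "r l i j \<le> e / 2" using low[of l] n l by (auto simp: not_less)
        have ln: "real CARD('v) * A \<le> \<eta> / 2 * real l"
        proof -
          have "2 * real CARD('v) * A / \<eta> \<le> real l" using n(2) l(2) by simp
          then show ?thesis using \<eta> by (simp add: field_simps)
        qed
        have ge: "\<eta> / 2 * real l \<le> wdeg (V l) a" if "\<eta> * real k < wdeg (V k) a" for a
          using that wdeg_growth[of l k a] ln \<eta> unfolding l(1) by (simp add: algebra_simps)
        have "real m \<le> S * real l" using m(2) l(2) S by (smt (verit) mult_left_mono of_nat_mono)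
        then have "\<bar>r m i j - r l i j\<bar> \<le> e / 2"
          using slow[of l m] ge[of i] ge[of j] k l n by auto
        with rl show ?thesis by linarith
      qed
      with rn r_nonneg[of m i j] r_nonneg[of n i j] show ?thesis by linarith
    qed
  qed
  have "\<forall>\<^sub>F n in sequentially. n1 \<le> n" by (rule eventually_ge_at_top)
  moreover have "\<forall>\<^sub>F n in sequentially. 2 * real CARD('v) * A / \<eta> \<le> real n"
    using filterlim_real_sequentially by (simp add: filterlim_at_top)
  ultimately show ?thesis by eventually_elim (use main in blast)
qed

text \<open>Let \<open>n\<close> be a small fixed fraction of \<open>m\<close>. On
  \<open>{n..<m}\<close> the rates stay near \<open>r m i j\<close> and their sum is nearly the
  gained weight, so \<open>V m i j\<close> is close to \<open>m * r m i j\<close> up to the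
  contribution of the first \<open>n\<close> steps, a small fraction of \<open>m\<close>.\<close>

lemma V_over_n: "(\<lambda>n. V n i j / real n - r n i j) \<longlonglongrightarrow> 0"
proof (rule LIMSEQ_I)
  fix e :: real assume e: "0 < e"
  \<comment> \<open>\<open>K * n\<close> bounds the neglected part
    \<open>V n i j + n * r m i j\<close> for positive \<open>n\<close>; \<open>s\<close> is then so
    large that this is at most \<open>e * m / 4\<close>.\<close>
  define K where "K = V 0 i j + A + Q"
  have K: "0 < K" using V_nonneg[of 0 i j] A Q_pos by (simp add: K_def)
  define s where "s = nat \<lceil>4 * K / e\<rceil>"
  have s: "4 * K / e \<le> real s" unfolding s_def by linarith
  have s_pos: "0 < s" using s K e by (cases "s = 0") (auto simp: divide_le_0_iff)
  define P1 where "P1 n \<longleftrightarrow> (\<forall>m\<ge>n. real m \<le> 2 * real s * real n \<longrightarrow> \<bar>r m i j - r n i j\<bar> \<le> e / 8)" for n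
  define P2 where "P2 n \<longleftrightarrow> (\<forall>m\<ge>n. \<bar>V m i j - V n i j - (\<Sum>k\<in>{n..<m}. r k i j)\<bar> \<le> e / 8 * real m)" for n
  have "eventually P1 sequentially"
    unfolding P1_def using s_pos e by (intro rate_slow) auto
  moreover have "eventually P2 sequentially"
    unfolding P2_def using e by (intro V_increment) auto
  ultimately have "\<forall>\<^sub>F n in sequentially. P1 n \<and> P2 n" by (rule eventually_conj)
  then obtain n1 where "\<And>n. n1 \<le> n \<Longrightarrow> P1 n" "\<And>n. n1 \<le> n \<Longrightarrow> P2 n"
    unfolding eventually_sequentially by blast
  note slow = this(1)[unfolded P1_def, rule_format] and incr = this(2)[unfolded P2_def, rule_format]
  show "\<exists>no. \<forall>m\<ge>no. norm (V m i j / real m - r m i j - 0) < e"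
  proof (intro exI allI impI)
    fix m assume m: "(n1 + 1) * s \<le> m"
    \<comment> \<open>Then \<open>n * s \<le> m\<close> makes the first \<open>n\<close> steps
      negligible, and \<open>m \<le> 2 * s * n\<close> keeps the window within the range of
      \<open>slow\<close>.\<close>
    define n where "n = m div s"
    have n_ge: "n1 + 1 \<le> n" using m s_pos by (simp add: n_def less_eq_div_iff_mult_less_eq)
    have nm: "n \<le> m" by (simp add: n_def)
    have ns: "real n * real s \<le> real m"
      unfolding n_def by (simp flip: of_nat_mult)
    have "m < (n + 1) * s" unfolding n_def using s_pos by (simp add: div_mult_mod_eq[symmetric] dividend_less_div_times add.commute)
    also have "\<dots> \<le> (2 * s) * n" using n_ge by (cases n) (auto simp: algebra_simps)
    finally have "real m \<le> real (2 * s * n)" by (simp only: of_nat_le_iff)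
    then have ms: "real m \<le> 2 * real s * real n" by simp
    have m_pos: "0 < real m" using n_ge nm by simp
    have rm: "\<bar>r k i j - r m i j\<bar> \<le> e / 4" if "k \<in> {n..<m}" for k
    proof -
      have "real k \<le> 2 * real s * real n" using that ms by simp
      then have "\<bar>r k i j - r n i j\<bar> \<le> e / 8" using slow[of n k] that n_ge by simp
      moreover have "\<bar>r m i j - r n i j\<bar> \<le> e / 8" using slow[of n m] nm ms n_ge by simp
      ultimately show ?thesis by linarith
    qed
    have "\<bar>\<Sum>k\<in>{n..<m}. r k i j - r m i j\<bar> \<le> (\<Sum>k\<in>{n..<m}. e / 4)"
      by (intro order_trans[OF sum_abs] sum_mono rm)
    also have "\<dots> \<le> real m * (e / 4)" using e by (simp add: mult_right_mono)
    finally have a: "\<bar>\<Sum>k\<in>{n..<m}. r k i j - r m i j\<bar> \<le> real m * (e / 4)" .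
    have b: "(\<Sum>k\<in>{n..<m}. r k i j - r m i j) = (\<Sum>k\<in>{n..<m}. r k i j) - (real m - real n) * r m i j"
      using nm by (simp add: sum_subtractf of_nat_diff)
    have "V n i j \<le> V 0 i j + A * real n" using V_growth[of 0 n i j] by simp
    also have "V 0 i j \<le> V 0 i j * real n"
      using n_ge V_nonneg[of 0 i j] by (simp add: mult_left_le[where c = "V 0 i j", simplified] mult_le_cancel_left1)
    finally have "V n i j \<le> (V 0 i j + A) * real n" by (simp add: distrib_right)
    moreover have "real n * r m i j \<le> Q * real n"
      using mult_right_mono[OF r_le, of "real n"] by (simp add: mult.commute)
    ultimately have Kn: "V n i j + real n * r m i j \<le> K * real n" by (simp add: K_def distrib_right)
    have "4 * K \<le> e * real s" using s e by (simp add: divide_le_eq mult.commute)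
    then have "4 * K * real n \<le> e * real s * real n" by (intro mult_right_mono) auto
    also have "\<dots> \<le> e * real m" using mult_left_mono[OF ns, of e] e by (simp add: mult_ac)
    finally have Km: "K * real n \<le> real m * (e / 4)" by (simp add: mult_ac)
    have c: "0 \<le> V n i j" "0 \<le> real n * r m i j" using V_nonneg r_nonneg by simp_all
    have i: "\<bar>V m i j - V n i j - (\<Sum>k\<in>{n..<m}. r k i j)\<bar> \<le> e / 8 * real m"
      using incr[of n m] n_ge nm by simp
    have combine: "\<bar>x - y\<bar> \<le> 7 / 8 * z"
      if "\<bar>t - (y - w)\<bar> \<le> z / 4" "\<bar>x - u - t\<bar> \<le> z / 8" "u + w \<le> z / 4" "0 \<le> u" "0 \<le> w"
      for x y t w u z :: real
      using that by linarith
    have "\<bar>V m i j - real m * r m i j\<bar> \<le> 7 / 8 * (e * real m)"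
      by (rule combine[where t = "\<Sum>k\<in>{n..<m}. r k i j" and u = "V n i j" and w = "real n * r m i j"])
         (use a[unfolded b] i Kn Km c in \<open>simp_all add: algebra_simps\<close>)
    then have "\<bar>(V m i j - real m * r m i j) / real m\<bar> \<le> 7 / 8 * e"
      using m_pos by (simp add: abs_divide divide_le_eq mult_ac)
    moreover have "(V m i j - real m * r m i j) / real m = V m i j / real m - r m i j"
      using m_pos by (simp add: diff_divide_distrib)
    ultimately show "norm (V m i j / real m - r m i j - 0) < e" using e by simp
  qed
qed

section \<open>The total weight and the vanishing of the drift\<close>

definition total :: "nat \<Rightarrow> real" where "total n = (\<Sum>i\<in>UNIV. \<Sum>j\<in>UNIV. V n i j)"

lemma total_over_n: "(\<lambda>n. total n / real n - H n) \<longlonglongrightarrow> 0"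
proof -
  have "(\<lambda>n. \<Sum>i\<in>UNIV. \<Sum>j\<in>UNIV. V n i j / real n - r n i j) \<longlonglongrightarrow> (\<Sum>i\<in>(UNIV :: 'v set). \<Sum>j\<in>(UNIV :: 'v set). 0)"
    by (intro tendsto_sum V_over_n)
  then show ?thesis by (simp add: sum_subtractf sum_divide_distrib total_def H_def)
qed

text \<open>After division by \<open>n\<close> the total and the entry of \<open>V\<close> are
  asymptotic to \<open>H n\<close> and \<open>r n i j\<close>, so the difference is a null sequence
  divided by \<open>total n / n\<close>. The lower bound \<open>c\<close> keeps the limit of that
  denominator positive.\<close>

lemma drift_vanishes: "(\<lambda>n. r n i j - V n i j / total n * H n) \<longlonglongrightarrow> 0"
proof -
  obtain h where h: "H \<longlonglongrightarrow> h" using H_convergent by (auto simp: convergent_def)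
  have "c \<le> h" by (rule LIMSEQ_le_const[OF h]) (use H_lower in \<open>auto simp: H_def\<close>)
  with c have h_pos: "0 < h" by simp
  have T: "(\<lambda>n. total n / real n) \<longlonglongrightarrow> h"
    using tendsto_add[OF total_over_n h] by simp
  have lim1: "(\<lambda>n. (total n / real n - H n) * r n i j) \<longlonglongrightarrow> 0"
    by (rule lim_null_mult_right_bounded[OF total_over_n, of _ Q])
       (simp add: r_le r_nonneg)
  have lim2: "(\<lambda>n. (V n i j / real n - r n i j) * H n) \<longlonglongrightarrow> 0"
    using tendsto_mult[OF V_over_n h] by simp
  have "(\<lambda>n. ((total n / real n - H n) * r n i j - (V n i j / real n - r n i j) * H n) / (total n / real n)) \<longlonglongrightarrow> (0 - 0) / h"
    by (intro tendsto_divide tendsto_diff lim1 lim2 T) (use h_pos in simp)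
  then have "(\<lambda>n. ((total n / real n - H n) * r n i j - (V n i j / real n - r n i j) * H n) / (total n / real n)) \<longlonglongrightarrow> 0"
    by simp
  moreover have "\<forall>\<^sub>F n in sequentially. ((total n / real n - H n) * r n i j - (V n i j / real n - r n i j) * H n) / (total n / real n)
      = r n i j - V n i j / total n * H n"
    using order_tendstoD(1)[OF T h_pos] eventually_gt_at_top[of 0]
  proof eventually_elim
    case (elim n)
    then have "total n \<noteq> 0" by auto
    have eq: "((t / n - H) * r - (v / n - r) * H) / (t / n) = r - v / t * H" if "t \<noteq> 0" "n \<noteq> 0" for t n H r v :: real
      using that by (simp add: field_simps)
    show ?case by (rule eq) (use elim \<open>total n \<noteq> 0\<close> in auto)
  qed
  ultimately show ?thesis by (rule Lim_transform_eventually)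
qed

end

section \<open>The network process\<close>

text \<open>For bounded increments the squared relative increment is at most a constant times
  \<open>1 / y k - 1 / y (Suc k)\<close>, and these differences telescope.\<close>

lemma sum_relative_increments_bound:
  fixes y :: "nat \<Rightarrow> real"
  assumes pos: "0 < y 0" and mono: "\<And>k. y k \<le> y (Suc k)" and incr: "\<And>k. y (Suc k) \<le> y k + B"
  shows "(\<Sum>k<n. ((y (Suc k) - y k) / y k)\<^sup>2) \<le> B * (1 + B / y 0) / y 0"
proof -
  have y: "y 0 \<le> y k" for k by (rule lift_Suc_mono_le) (use mono in auto)
  have B: "0 \<le> B" using mono[of 0] incr[of 0] by linarith
  have bound1: "((y (Suc k) - y k) / y k)\<^sup>2 \<le> B * (1 + B / y 0) * (1 / y k - 1 / y (Suc k))" for k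
  proof -
    let ?d = "y (Suc k) - y k"
    have yk: "0 < y k" "0 < y (Suc k)" using y[of k] y[of "Suc k"] pos by linarith+
    have d: "0 \<le> ?d" "?d \<le> B" using mono[of k] incr[of k] by linarith+
    have "y (Suc k) / y k = 1 + ?d / y k" using yk by (simp add: field_simps)
    also have "?d / y k \<le> B / y 0" using d yk pos y[of k] by (intro frac_le) auto
    finally have ratio: "y (Suc k) / y k \<le> 1 + B / y 0" by simp
    have diff: "1 / y k - 1 / y (Suc k) = ?d / (y k * y (Suc k))" using yk by (simp add: field_simps)
    have "(?d / y k)\<^sup>2 = ?d * (y (Suc k) / y k) * (?d / (y k * y (Suc k)))"
      using yk by (simp add: field_simps power2_eq_square)
    also have "\<dots> \<le> B * (1 + B / y 0) * (?d / (y k * y (Suc k)))"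
      using d yk ratio B by (intro mult_right_mono mult_mono) auto
    finally show ?thesis unfolding diff .
  qed
  have "(\<Sum>k<n. ((y (Suc k) - y k) / y k)\<^sup>2) \<le> (\<Sum>k<n. B * (1 + B / y 0) * (1 / y k - 1 / y (Suc k)))"
    by (intro sum_mono bound1)
  also have "\<dots> = B * (1 + B / y 0) * (1 / y 0 - 1 / y n)"
    by (simp only: sum_lessThan_telescope'[of "\<lambda>k. 1 / y k"] flip: sum_distrib_left)
  also have "\<dots> \<le> B * (1 + B / y 0) * (1 / y 0)"
    using B pos y[of n] by (intro mult_left_mono) auto
  finally show ?thesis by simp
qed

lemma sum_inverse_squares_bound: "\<exists>B. \<forall>n. (\<Sum>k<n. (1 / real (Suc k))\<^sup>2) \<le> B"
proof -
  have "summable (\<lambda>n. inverse ((real n) ^ 2))" by (rule inverse_power_summable) simp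
  then have "summable (\<lambda>n. (1 / real (Suc n))\<^sup>2)"
    using summable_Suc_iff[of "\<lambda>n. inverse ((real n) ^ 2)"] by (simp add: power_divide inverse_eq_divide)
  then have "(\<Sum>k<n. (1 / real (Suc k))\<^sup>2) \<le> (\<Sum>k. (1 / real (Suc k))\<^sup>2)" for n
    by (intro sum_le_suminf) auto
  then show ?thesis by blast
qed

section \<open>Independent choices of the vertices\<close>

lemma sum_UNIV_prod:
  fixes f :: "'a::finite \<times> 'b::finite \<Rightarrow> real"
  shows "(\<Sum>s\<in>UNIV. f s) = (\<Sum>x\<in>UNIV. \<Sum>y\<in>UNIV. f (x, y))"
  by (simp add: sum.cartesian_product)

lemma sum_functions_prod:
  fixes f :: "'v::finite \<Rightarrow> 'v \<Rightarrow> real"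
  shows "(\<Sum>c\<in>UNIV. \<Prod>i\<in>UNIV. f i (c i)) = (\<Prod>i\<in>UNIV. \<Sum>j\<in>UNIV. f i j)"
  using prod_sum_PiE[of "UNIV :: 'v set" "\<lambda>_. UNIV :: 'v set" f] by (simp add: PiE_UNIV_domain)

lemma choice_prob_sum: "(\<Sum>j\<in>UNIV. choice_prob V i j) = 1"
proof (cases "(\<Sum>k\<in>UNIV. V i k) = 0")
  case False
  then show ?thesis by (simp add: choice_prob_def flip: sum_divide_distrib)
qed (simp add: choice_prob_def)

lemma choice_prob_nonneg: "(\<And>i j. 0 \<le> V i j) \<Longrightarrow> 0 \<le> choice_prob V i j"
  by (simp add: choice_prob_def sum_nonneg)

lemma sum_mutual_choice:
  fixes f :: "'v::finite \<Rightarrow> 'v \<Rightarrow> real"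
  assumes f: "\<And>k. (\<Sum>l\<in>UNIV. f k l) = 1" and ij: "i \<noteq> j"
  shows "(\<Sum>c\<in>UNIV. (\<Prod>k\<in>UNIV. f k (c k)) * (if c i = j \<and> c j = i then 1 else 0)) = f i j * f j i"
proof -
  \<comment> \<open>\<open>g\<close> is \<open>f\<close> with the choices of \<open>i\<close> and
    \<open>j\<close> forced, which turns the constrained sum into one that factorises over the
    vertices.\<close>
  define g where "g k l = (if k = i then if l = j then f k l else 0
    else if k = j then if l = i then f k l else 0 else f k l)" for k l
  have split: "(\<Prod>k\<in>UNIV. h k) = h i * h j * (\<Prod>k\<in>UNIV - {i, j}. h k)" for h :: "'v \<Rightarrow> real"
  proof -
    have "(\<Prod>k\<in>UNIV. h k) = (\<Prod>k\<in>{i, j}. h k) * (\<Prod>k\<in>UNIV - {i, j}. h k)"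
      by (subst prod.subset_diff[of "{i, j}"]) (auto simp: mult.commute)
    then show ?thesis using ij by simp
  qed
  have rest: "(\<Prod>k\<in>UNIV - {i, j}. g k (c k)) = (\<Prod>k\<in>UNIV - {i, j}. f k (c k))" for c
    by (intro prod.cong refl) (auto simp: g_def)
  have "(\<Prod>k\<in>UNIV. f k (c k)) * (if c i = j \<and> c j = i then 1 else 0) = (\<Prod>k\<in>UNIV. g k (c k))" for c
    unfolding split[of "\<lambda>k. f k (c k)"] split[of "\<lambda>k. g k (c k)"] rest using ij by (auto simp: g_def)
  then have "(\<Sum>c\<in>UNIV. (\<Prod>k\<in>UNIV. f k (c k)) * (if c i = j \<and> c j = i then 1 else 0))
      = (\<Sum>c\<in>UNIV. \<Prod>k\<in>UNIV. g k (c k))" by simp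
  also have "\<dots> = (\<Prod>k\<in>UNIV. \<Sum>l\<in>UNIV. g k l)" by (rule sum_functions_prod)
  also have "\<dots> = (\<Sum>l\<in>UNIV. g i l) * (\<Sum>l\<in>UNIV. g j l) * (\<Prod>k\<in>UNIV - {i, j}. \<Sum>l\<in>UNIV. g k l)"
    by (rule split)
  also have "(\<Prod>k\<in>UNIV - {i, j}. \<Sum>l\<in>UNIV. g k l) = 1"
    by (rule prod.neutral) (auto simp: g_def f)
  also have "(\<Sum>l\<in>UNIV. g i l) = f i j" by (simp add: g_def)
  also have "(\<Sum>l\<in>UNIV. g j l) = f j i" using ij by (simp add: g_def)
  finally show ?thesis by simp
qed

locale network =
  fixes adj :: "'v::finite \<Rightarrow> 'v \<Rightarrow> bool" and a :: "'v \<Rightarrow> 'v \<Rightarrow> real"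
    and p :: "'v set \<Rightarrow> real" and v0 :: "'v \<Rightarrow> 'v \<Rightarrow> real"
  assumes adj_sym: "\<And>i j. adj i j \<longleftrightarrow> adj j i"
    and adj_irrefl: "\<And>i. \<not> adj i i"
    and a_nonneg: "\<And>i j. a i j \<ge> 0"
    and a_sym: "\<And>i j. a i j = a j i"
    and a_adj: "\<And>i j. a i j > 0 \<Longrightarrow> adj i j"
    and p_nonneg: "\<And>W. p W \<ge> 0"
    and p_sum: "(\<Sum>W\<in>UNIV. p W) = 1"
    and ap_pos: "\<exists>i j. a i j * pp adj p i j > 0"
    and v0_sym: "\<And>i j. v0 i j = v0 j i"
    and v0_nonneg: "\<And>i j. v0 i j \<ge> 0"
    and v0_pos: "\<And>i j. v0 i j > 0 \<longleftrightarrow> adj i j"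
begin

definition q :: "'v \<Rightarrow> 'v \<Rightarrow> real" where "q i j = a i j * pp adj p i j"

lemma pp_nonneg: "0 \<le> pp adj p i j"
  by (simp add: pp_def sum_nonneg p_nonneg)

lemma q_nonneg: "0 \<le> q i j"
  by (simp add: q_def a_nonneg pp_nonneg)

lemma q_sym: "q i j = q j i"
  unfolding q_def pp_def by (simp add: a_sym[of i j] adj_sym[of i j] conj_commute)

lemma q_pos_adj: "q i j \<noteq> 0 \<Longrightarrow> adj i j"
  using a_adj[of i j] a_nonneg[of i j] by (cases "a i j = 0") (auto simp: q_def)

lemma v0_off: "\<not> adj i j \<Longrightarrow> v0 i j = 0"
  using v0_pos[of i j] v0_nonneg[of i j] by simp

lemma v0_total_pos: "0 < (\<Sum>k\<in>UNIV. \<Sum>l\<in>UNIV. v0 k l)"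
proof -
  obtain i j where "q i j > 0" using ap_pos by (auto simp: q_def)
  then have "0 < v0 i j" using q_pos_adj[of i j] v0_pos by simp
  with double_member_le_sum[of v0 i j] v0_nonneg show ?thesis by force
qed

lemma h1_pos: "0 < h1 adj a p v0"
proof -
  obtain i j where ij: "q i j > 0" using ap_pos by (auto simp: q_def)
  then have v: "0 < v0 i j" using q_pos_adj[of i j] v0_pos by simp
  have "v0 i j \<le> (\<Sum>(i, j)\<in>{(i, j). a i j * pp adj p i j > 0}. v0 i j)"
    using member_le_sum[of "(i, j)" "{(i, j). a i j * pp adj p i j > 0}" "\<lambda>(i, j). v0 i j"] ij v0_nonneg
    by (auto simp: q_def)
  with v v0_total_pos show ?thesis by (simp add: h1_def)
qed

section \<open>The rates as functions on \<open>Delta\<close>\<close>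

definition \<rho> :: "real^'v^'v \<Rightarrow> 'v \<Rightarrow> 'v \<Rightarrow> real" where
  "\<rho> x i j = q i j * (x $ i $ j)\<^sup>2 / (rowsum x i * rowsum x j)"

lemma Delta_nonneg: "x \<in> Delta adj a p v0 \<Longrightarrow> 0 \<le> x $ i $ j"
  by (simp add: Delta_def)

lemma Delta_entry_le: "x \<in> Delta adj a p v0 \<Longrightarrow> x $ i $ j \<le> rowsum x i"
  unfolding rowsum_def by (rule member_le_sum) (auto simp: Delta_nonneg)

lemma Delta_entry_le': "x \<in> Delta adj a p v0 \<Longrightarrow> x $ i $ j \<le> rowsum x j"
  using Delta_entry_le[of x j i] by (simp add: Delta_def)

lemma Delta_rowsum_le: "x \<in> Delta adj a p v0 \<Longrightarrow> rowsum x i \<le> 1"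
  using member_le_sum[of i UNIV "rowsum x"]
  by (auto simp: Delta_def rowsum_def sum_nonneg)

lemma \<rho>_nonneg: "x \<in> Delta adj a p v0 \<Longrightarrow> 0 \<le> \<rho> x i j"
  unfolding \<rho>_def rowsum_def
  by (intro divide_nonneg_nonneg mult_nonneg_nonneg sum_nonneg q_nonneg zero_le_power2 Delta_nonneg)

lemma Hfun_eq:
  assumes "x \<in> Delta adj a p v0"
  shows "Hfun adj a p x = (\<Sum>i\<in>UNIV. \<Sum>j\<in>UNIV. \<rho> x i j)"
proof -
  have "Hfun adj a p x = (\<Sum>(i, j)\<in>{(i, j). x $ i $ j > 0}. \<rho> x i j)"
    by (simp add: Hfun_def \<rho>_def q_def)
  also have "\<dots> = (\<Sum>(i, j)\<in>UNIV \<times> UNIV. \<rho> x i j)"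
    by (rule sum.mono_neutral_left)
       (use Delta_nonneg[OF assms] in \<open>auto simp: \<rho>_def less_le\<close>)
  finally show ?thesis by (simp add: sum.cartesian_product)
qed

lemma Fmap_eq:
  assumes "x \<in> Delta adj a p v0"
  shows "Fmap adj a p x $ i $ j = \<rho> x i j - x $ i $ j * Hfun adj a p x"
  by (simp add: Fmap_def ratio_def \<rho>_def q_def power2_eq_square algebra_simps)

text \<open>Mass at least \<open>h1\<close> lies on the finitely many pairs with positive
  coefficient, so one of them carries at least the average \<open>t\<close>. As row sums are at most
  one, this pair alone contributes at least \<open>m * t\<^sup>2\<close>.\<close>

lemma Hfun_lower:
  obtains c where "0 < c" "\<And>x. x \<in> Delta adj a p v0 \<Longrightarrow> c \<le> (\<Sum>i\<in>UNIV. \<Sum>j\<in>UNIV. \<rho> x i j)"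
proof -
  let ?P = "{(i, j). a i j * pp adj p i j > 0}"
  define m where "m = Min ((\<lambda>(i, j). q i j) ` ?P)"
  have ne: "?P \<noteq> {}" using ap_pos by auto
  have "0 < m" unfolding m_def using ne by (auto simp: q_def Min_gr_iff)
  moreover have "m \<le> q i j" if "(i, j) \<in> ?P" for i j
    unfolding m_def using that by (intro Min_le) force+
  ultimately have m: "0 < m" "\<And>i j. (i, j) \<in> ?P \<Longrightarrow> m \<le> q i j" by blast+
  define t where "t = h1 adj a p v0 / real (card ?P)"
  have cP: "0 < card ?P" using ne by (simp add: card_gt_0_iff)
  have t: "0 < t" using h1_pos cP by (simp add: t_def)
  have "m * t\<^sup>2 \<le> (\<Sum>i\<in>UNIV. \<Sum>j\<in>UNIV. \<rho> x i j)" if x: "x \<in> Delta adj a p v0" for x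
  proof -
    have "\<exists>(i, j)\<in>?P. t \<le> x $ i $ j"
    proof (rule ccontr)
      assume "\<not> ?thesis"
      then have "(\<Sum>(i, j)\<in>?P. x $ i $ j) < (\<Sum>(i, j)\<in>?P. t)"
        using ne by (intro sum_strict_mono) (auto simp: not_le)
      also have "\<dots> = h1 adj a p v0" using cP ne by (auto simp: t_def)
      finally show False using x by (simp add: Delta_def)
    qed
    then obtain i j where ij: "(i, j) \<in> ?P" "t \<le> x $ i $ j" by auto
    have xi: "0 < rowsum x i" "0 < rowsum x j"
      using ij(2) t Delta_entry_le[OF x, of i j] Delta_entry_le'[OF x, of i j] by linarith+
    have "m * t\<^sup>2 \<le> q i j * (x $ i $ j)\<^sup>2"
      using m ij t by (intro mult_mono power_mono) (auto simp: q_nonneg)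
    also have "\<dots> \<le> \<rho> x i j"
    proof -
      have "rowsum x i * rowsum x j \<le> 1"
        using xi Delta_rowsum_le[OF x] by (intro mult_le_one) auto
      moreover have "0 \<le> q i j * (x $ i $ j)\<^sup>2" using q_nonneg by simp
      ultimately have "q i j * (x $ i $ j)\<^sup>2 * (rowsum x i * rowsum x j) \<le> q i j * (x $ i $ j)\<^sup>2"
        using mult_left_mono[of "rowsum x i * rowsum x j" 1] by fastforce
      then show ?thesis using xi by (simp add: \<rho>_def le_divide_eq)
    qed
    also have "\<dots> \<le> (\<Sum>i\<in>UNIV. \<Sum>j\<in>UNIV. \<rho> x i j)"
      by (rule double_member_le_sum) (rule \<rho>_nonneg[OF x])
    finally show ?thesis .
  qed
  moreover have "0 < m * t\<^sup>2" using m t by simp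
  ultimately show thesis using that by blast
qed

lemma compact_Delta: "compact (Delta adj a p v0)"
  unfolding compact_eq_bounded_closed
proof
  have "norm x \<le> 1" if x: "x \<in> Delta adj a p v0" for x
  proof -
    have "norm x \<le> (\<Sum>i\<in>UNIV. norm (x $ i))" unfolding norm_vec_def by (intro L2_set_le_sum) auto
    also have "\<dots> \<le> (\<Sum>i\<in>UNIV. \<Sum>j\<in>UNIV. \<bar>x $ i $ j\<bar>)" by (intro sum_mono norm_le_l1_cart)
    also have "\<dots> = 1" using x by (simp add: Delta_def)
    finally show ?thesis .
  qed
  then show "bounded (Delta adj a p v0)" by (auto simp: bounded_iff)
  have "Delta adj a p v0 = (\<Inter>i. \<Inter>j. {x. x $ i $ j = x $ j $ i} \<inter> {x. 0 \<le> x $ i $ j} \<inter> {x. \<not> adj i j \<longrightarrow> x $ i $ j = 0})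
      \<inter> {x. (\<Sum>i\<in>UNIV. \<Sum>j\<in>UNIV. x $ i $ j) = 1}
      \<inter> {x. h1 adj a p v0 \<le> (\<Sum>e\<in>{(i, j). a i j * pp adj p i j > 0}. x $ fst e $ snd e)}"
    by (auto simp: Delta_def case_prod_beta)
  moreover have "closed \<dots>"
    by (intro closed_Int closed_INT ballI closed_Collect_eq closed_Collect_le closed_Collect_imp
        continuous_intros open_Collect_const)
  ultimately show "closed (Delta adj a p v0)" by simp
qed

text \<open>\<open>Fmap\<close> is not continuous where some \<open>rowsum x i\<close> vanishes, but the rates of the edges that
  survive in the limit are, and along the sequence these already exhaust the limit of \<open>Hfun\<close>.\<close>
lemma infdist_Gamma_tendsto:
  assumes x: "\<And>n. x n \<in> Delta adj a p v0"
    and F: "(\<lambda>n. Fmap adj a p (x n)) \<longlonglongrightarrow> 0"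
    and H: "convergent (\<lambda>n. Hfun adj a p (x n))"
  shows "(\<lambda>n. infdist (x n) (Gamma adj a p v0)) \<longlonglongrightarrow> 0"
proof (rule ccontr)
  let ?d = "\<lambda>n. infdist (x n) (Gamma adj a p v0)"
  assume "\<not> ?d \<longlonglongrightarrow> 0"
  then obtain e where e: "0 < e" "\<And>N. \<exists>n\<ge>N. e \<le> ?d n"
    unfolding LIMSEQ_iff by (auto simp: not_less infdist_nonneg)
  have inf: "infinite {n. e \<le> ?d n}"
    unfolding infinite_nat_iff_unbounded_le using e(2) by blast
  \<comment> \<open>A subsequence that stays at distance at least \<open>e\<close> from
    \<open>Gamma\<close>; by compactness a further one converges to some \<open>l\<close> in
    \<open>Delta\<close>.\<close>
  define \<sigma> where "\<sigma> = enumerate {n. e \<le> ?d n}"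
  have \<sigma>: "strict_mono \<sigma>" "e \<le> ?d (\<sigma> n)" for n
    using strict_mono_enumerate[OF inf] enumerate_in_set[OF inf, of n] by (auto simp: \<sigma>_def)
  have "\<forall>n. (x \<circ> \<sigma>) n \<in> Delta adj a p v0" using x by simp
  then obtain l \<tau> where l: "l \<in> Delta adj a p v0" and \<tau>: "strict_mono \<tau>" "((x \<circ> \<sigma>) \<circ> \<tau>) \<longlonglongrightarrow> l"
    using compact_Delta unfolding compact_def by blast
  define y where "y n = x (\<sigma> (\<tau> n))" for n
  have yl: "y \<longlonglongrightarrow> l" using \<tau>(2) by (simp add: y_def[abs_def] o_def)
  have sub: "strict_mono (\<sigma> \<circ> \<tau>)" by (rule strict_mono_o[OF \<sigma>(1) \<tau>(1)])
  obtain h where "(\<lambda>n. Hfun adj a p (x n)) \<longlonglongrightarrow> h" using H by (auto simp: convergent_def)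
  from LIMSEQ_subseq_LIMSEQ[OF this sub] have h: "(\<lambda>n. Hfun adj a p (y n)) \<longlonglongrightarrow> h"
    by (simp add: o_def y_def)
  have yF: "(\<lambda>n. Fmap adj a p (y n) $ i $ j) \<longlonglongrightarrow> 0" for i j
    using tendsto_vec_nth[OF tendsto_vec_nth[OF LIMSEQ_subseq_LIMSEQ[OF F sub]], of i j]
    by (simp add: o_def y_def)
  have yij: "(\<lambda>n. y n $ i $ j) \<longlonglongrightarrow> l $ i $ j" for i j
    by (intro tendsto_vec_nth yl)
  have lim: "(\<lambda>n. \<rho> (y n) i j) \<longlonglongrightarrow> l $ i $ j * h" for i j
  proof -
    have "(\<lambda>n. Fmap adj a p (y n) $ i $ j + y n $ i $ j * Hfun adj a p (y n)) \<longlonglongrightarrow> 0 + l $ i $ j * h"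
      by (intro tendsto_add tendsto_mult yF yij h)
    then show ?thesis using x by (simp add: Fmap_eq y_def)
  qed
  have \<rho>l: "\<rho> l i j = l $ i $ j * h" for i j
  proof (cases "l $ i $ j = 0")
    case False
    then have pos: "0 < l $ i $ j" using Delta_nonneg[OF l, of i j] by simp
    have "0 < rowsum l i" "0 < rowsum l j"
      using pos Delta_entry_le[OF l, of i j] Delta_entry_le'[OF l, of i j] by linarith+
    moreover have "(\<lambda>n. rowsum (y n) i) \<longlonglongrightarrow> rowsum l i" for i
      unfolding rowsum_def by (intro tendsto_sum yij)
    ultimately have "(\<lambda>n. \<rho> (y n) i j) \<longlonglongrightarrow> \<rho> l i j"
      unfolding \<rho>_def by (intro tendsto_intros yij) auto
    then show ?thesis using lim LIMSEQ_unique by blast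
  qed (simp add: \<rho>_def)
  \<comment> \<open>The entries of \<open>l\<close> add up to one, so the limiting rates
    \<open>l $ i $ j * h\<close> add up to \<open>h\<close>. No part of the limit of
    \<open>Hfun\<close> is lost on the entries that vanish in the limit, and \<open>l\<close> is a
    zero of \<open>Fmap\<close>.\<close>
  have "Hfun adj a p l = (\<Sum>i\<in>UNIV. \<Sum>j\<in>UNIV. l $ i $ j) * h"
    by (simp add: Hfun_eq[OF l] \<rho>l sum_distrib_right)
  then have "Hfun adj a p l = h" using l by (simp add: Delta_def)
  then have "Fmap adj a p l = 0" by (simp add: vec_eq_iff Fmap_eq[OF l] \<rho>l)
  with l have G: "l \<in> Gamma adj a p v0" by (simp add: Gamma_def)
  have "(\<lambda>n. dist (y n) l) \<longlonglongrightarrow> 0" using yl tendsto_dist_iff by blast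
  moreover have "e \<le> dist (y n) l" for n
    using \<sigma>(2)[of "\<tau> n"] infdist_le[OF G, of "y n"] by (simp add: y_def)
  ultimately have "e \<le> 0" by (intro LIMSEQ_le_const) auto
  with e(1) show False by simp
qed

section \<open>The weights as functionals of the history\<close>

definition weights :: "nat \<Rightarrow> (nat \<Rightarrow> ('v \<Rightarrow> 'v) \<times> 'v set) \<Rightarrow> 'v \<Rightarrow> 'v \<Rightarrow> real" where
  "weights n h = Vproc adj a v0 (\<lambda>k. fst (h k)) (\<lambda>k. snd (h k)) n"

definition gain :: "nat \<Rightarrow> (nat \<Rightarrow> ('v \<Rightarrow> 'v) \<times> 'v set) \<Rightarrow> 'v \<Rightarrow> 'v \<Rightarrow> real" where
  "gain n h i j = (if adj i j \<and> i \<in> snd (h n) \<and> j \<in> snd (h n) \<and> fst (h n) i = j \<and> fst (h n) j = i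
    then a i j else 0)"

definition A :: real where "A = 1 + (\<Sum>i\<in>UNIV. \<Sum>j\<in>UNIV. a i j)"

lemma weights_0: "weights 0 h = v0"
  by (auto simp: weights_def v0_off intro!: ext)

lemma weights_Suc: "weights (Suc n) h i j = weights n h i j + gain n h i j"
  by (simp add: weights_def gain_def)

lemma dep_gain: "dep (Suc n) (gain n)"
  unfolding dep_def by (intro allI impI ext) (simp add: gain_def)

lemma dep_weights: "dep n (weights n)"
proof (induction n)
  case 0 then show ?case by (simp add: weights_0[abs_def] dep_def)
next
  case (Suc n)
  have "dep (Suc n) (\<lambda>h. (\<lambda>V U i j. V i j + U i j) (weights n h) (gain n h))"
    by (rule dep_comp2[OF dep_mono[OF Suc] dep_gain]) simp
  moreover have "weights (Suc n) = (\<lambda>h. (\<lambda>V U i j. V i j + U i j) (weights n h) (gain n h))"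
    by (intro ext) (simp add: weights_Suc)
  ultimately show ?case by simp
qed

lemma gain_nonneg: "0 \<le> gain n h i j"
  by (simp add: gain_def a_nonneg)

lemma A_ge_1: "1 \<le> A"
  by (simp add: A_def sum_nonneg a_nonneg)

lemma gain_le: "gain n h i j \<le> A"
  using double_member_le_sum[of a i j] a_nonneg A_ge_1 by (auto simp: gain_def A_def)

lemma gain_sym: "gain n h i j = gain n h j i"
  using adj_sym[of i j] a_sym[of i j] by (auto simp: gain_def)

lemma weights_ge: "v0 i j \<le> weights n h i j"
  by (induction n) (auto simp: weights_0 weights_Suc gain_nonneg intro: add_increasing2)

lemma weights_nonneg: "0 \<le> weights n h i j"
  by (rule order_trans[OF v0_nonneg weights_ge])

lemma weights_sym: "weights n h i j = weights n h j i"
  by (induction n) (auto simp: weights_0 v0_sym weights_Suc gain_sym)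

lemma weights_off: "\<not> adj i j \<Longrightarrow> weights n h i j = 0"
  by (induction n) (auto simp: weights_0 v0_off weights_Suc gain_def)

lemma wdeg_weights_pos: "adj i j \<Longrightarrow> 0 < wdeg (weights n h) i"
  using entry_le_wdeg[of "weights n h" i j, OF weights_nonneg] weights_ge[of i j n h] v0_pos[of i j] by simp

lemma wdeg_weights_Suc: "wdeg (weights (Suc n) h) i = wdeg (weights n h) i + wdeg (gain n h) i"
  by (simp add: weights_Suc[abs_def] wdeg_add)

lemma wdeg_gain_le: "wdeg (gain n h) i \<le> real CARD('v) * A"
  using sum_mono[of UNIV "gain n h i" "\<lambda>_. A"] by (simp add: wdeg_def gain_le)

text \<open>The squared relative increment of a degree. Up to constants the jumps at the two
  endpoints dominate both the second order error of a rate and the square of its increment.\<close>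

definition jump :: "'v \<Rightarrow> nat \<Rightarrow> (nat \<Rightarrow> ('v \<Rightarrow> 'v) \<times> 'v set) \<Rightarrow> real" where
  "jump i n h = (wdeg (gain n h) i / wdeg (weights n h) i)\<^sup>2"

lemma jump_nonneg: "0 \<le> jump i n h"
  by (simp add: jump_def)

lemma dep_jump: "dep (Suc n) (jump i n)"
proof -
  have "dep (Suc n) (\<lambda>h. (\<lambda>V U. (wdeg U i / wdeg V i)\<^sup>2) (weights n h) (gain n h))"
    by (rule dep_comp2[OF dep_mono[OF dep_weights] dep_gain]) simp
  then show ?thesis by (simp add: jump_def[abs_def])
qed

lemma jump_summable: "\<exists>B. \<forall>n h. (\<Sum>k<n. jump i k h) \<le> B"
proof (cases "\<exists>j. adj i j")
  case True
  then obtain j where j: "adj i j" by blast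
  let ?B = "real CARD('v) * A" and ?y = "\<lambda>h k. wdeg (weights k h) i"
  have "(\<Sum>k<n. jump i k h) \<le> ?B * (1 + ?B / wdeg v0 i) / wdeg v0 i" for n h
  proof -
    have "(\<Sum>k<n. ((?y h (Suc k) - ?y h k) / ?y h k)\<^sup>2) \<le> ?B * (1 + ?B / ?y h 0) / ?y h 0"
    proof (rule sum_relative_increments_bound)
      show "?y h k \<le> ?y h (Suc k)" "?y h (Suc k) \<le> ?y h k + ?B" for k
        using wdeg_gain_le[of k h i] wdeg_nonneg[of "gain k h" i, OF gain_nonneg]
        by (simp_all add: wdeg_weights_Suc)
    qed (rule wdeg_weights_pos[OF j])
    then show ?thesis by (simp add: jump_def wdeg_weights_Suc weights_0)
  qed
  then show ?thesis by blast
next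
  case False
  then have "jump i k h = 0" for k h by (simp add: jump_def wdeg_def gain_def)
  then show ?thesis by auto
qed

abbreviation rt :: "nat \<Rightarrow> (nat \<Rightarrow> ('v \<Rightarrow> 'v) \<times> 'v set) \<Rightarrow> 'v \<Rightarrow> 'v \<Rightarrow> real" where
  "rt n h \<equiv> rate q (weights n h)"

lemma rate_weights_Suc:
  "\<bar>rt (Suc n) h i j - rt n h i j - drate q (weights n h) (gain n h) i j\<bar> \<le> 2 * q i j * (jump i n h + jump j n h)"
  "(rt (Suc n) h i j - rt n h i j)\<^sup>2 \<le> 2 * (q i j)\<^sup>2 * (jump i n h + jump j n h)"
proof -
  let ?x = "wdeg (gain n h) i / wdeg (weights n h) i" and ?y = "wdeg (gain n h) j / wdeg (weights n h) j"
  have eq: "weights (Suc n) h = (\<lambda>i j. weights n h i j + gain n h i j)"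
    by (intro ext weights_Suc)
  have pos: "q i j \<noteq> 0 \<Longrightarrow> 0 < wdeg (weights n h) i" "q i j \<noteq> 0 \<Longrightarrow> 0 < wdeg (weights n h) j"
    using wdeg_weights_pos[of i j] wdeg_weights_pos[of j i] q_pos_adj[of i j] adj_sym[of i j] by auto
  note b = rate_add[where V = "weights n h" and U = "gain n h" and q = q and i = i and j = j,
      OF weights_nonneg gain_nonneg q_nonneg pos, folded eq]
  show "\<bar>rt (Suc n) h i j - rt n h i j - drate q (weights n h) (gain n h) i j\<bar> \<le> 2 * q i j * (jump i n h + jump j n h)"
    using b(2) by (simp add: jump_def)
  have "(rt (Suc n) h i j - rt n h i j)\<^sup>2 \<le> (q i j * (?x + ?y))\<^sup>2"
    using b(1) abs_le_square_iff[of "rt (Suc n) h i j - rt n h i j" "q i j * (?x + ?y)"] by linarith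
  also have "\<dots> \<le> (q i j)\<^sup>2 * (2 * (?x\<^sup>2 + ?y\<^sup>2))"
    unfolding power_mult_distrib using sum_squares_bound[of ?x ?y]
    by (intro mult_left_mono) (auto simp: power2_sum)
  finally show "(rt (Suc n) h i j - rt n h i j)\<^sup>2 \<le> 2 * (q i j)\<^sup>2 * (jump i n h + jump j n h)"
    by (simp add: jump_def algebra_simps)
qed

text \<open>The weight on pairs with \<open>q i j = 0\<close> keeps its initial value
  \<open>R\<close>, so the remaining fraction \<open>(T - R) / T\<close> starts at \<open>h1\<close>
  and does not decrease as the total \<open>T\<close> grows. The hypothesis \<open>frozen\<close>
  describes an almost sure event: an edge with \<open>a i j > 0\<close> may have
  \<open>pp adj p i j = 0\<close>.\<close>

lemma xarr_Delta:
  assumes frozen: "\<And>k i j. q i j = 0 \<Longrightarrow> gain k h i j = 0"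
  shows "xarr (weights n h) \<in> Delta adj a p v0"
proof -
  let ?T = "\<lambda>n. \<Sum>k\<in>UNIV. \<Sum>l\<in>UNIV. weights n h k l"
  define P where "P = {(i, j). a i j * pp adj p i j > 0}"
  let ?S = "\<lambda>n. \<Sum>(i, j)\<in>P. weights n h i j"
  define R where "R = ?T 0 - ?S 0"
  have T0: "0 < ?T 0" using v0_total_pos by (simp add: weights_0)
  have TT: "?T 0 \<le> ?T n" for n
    by (intro sum_mono) (simp add: weights_0 weights_ge)
  have Tn: "0 < ?T n" using T0 TT[of n] by linarith
  have P_iff: "(i, j) \<in> P \<longleftrightarrow> q i j \<noteq> 0" for i j
    using q_nonneg[of i j] by (auto simp: P_def q_def less_le)
  have "?T n - ?S n = R" for n
  proof (induction n)
    case (Suc n)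
    have "(\<Sum>i\<in>UNIV. \<Sum>j\<in>UNIV. gain n h i j) = (\<Sum>(i, j)\<in>P. gain n h i j)"
      unfolding sum.cartesian_product
      by (rule sum.mono_neutral_right) (use frozen P_iff in auto)
    then show ?case using Suc by (simp add: weights_Suc sum.distrib case_prod_beta)
  qed (simp add: R_def)
  from this[of n] have S: "?S n = ?T n - R" by simp
  have "?S 0 \<le> ?T 0"
    unfolding sum.cartesian_product by (rule sum_mono2) (auto simp: weights_nonneg)
  then have R: "0 \<le> R" by (simp add: R_def)
  have "h1 adj a p v0 = (?T 0 - R) / ?T 0"
    by (simp add: h1_def R_def P_def weights_0)
  also have "\<dots> \<le> (?T n - R) / ?T n"
  proof -
    have "R / ?T n \<le> R / ?T 0" using R T0 TT Tn by (intro divide_left_mono mult_pos_pos) auto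
    then show ?thesis using T0 Tn by (simp add: diff_divide_distrib)
  qed
  finally have h1: "h1 adj a p v0 \<le> (\<Sum>(i, j)\<in>P. weights n h i j / ?T n)"
    by (simp add: S[symmetric] sum_divide_distrib case_prod_beta)
  have "(\<Sum>i\<in>UNIV. \<Sum>j\<in>UNIV. weights n h i j / ?T n) = 1"
    using Tn by (simp flip: sum_divide_distrib)
  with h1 show ?thesis
    using weights_sym[of n h] weights_nonneg[of n h] weights_off[of _ _ n h] Tn
    by (auto simp: Delta_def xarr_def P_def case_prod_beta)
qed

text \<open>Rates are homogeneous of degree zero in the weights, so the normalisation
  cancels.\<close>

lemma \<rho>_xarr: "\<rho> (xarr (weights n h)) i j = rt n h i j"
proof -
  let ?T = "\<Sum>k\<in>UNIV. \<Sum>l\<in>UNIV. weights n h k l"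
  have "(\<Sum>k\<in>UNIV. \<Sum>l\<in>UNIV. v0 k l) \<le> ?T" by (intro sum_mono weights_ge)
  then have T: "?T \<noteq> 0" using v0_total_pos by linarith
  have r: "rowsum (xarr (weights n h)) i = wdeg (weights n h) i / ?T" for i
    by (simp add: rowsum_def xarr_def wdeg_def flip: sum_divide_distrib)
  show ?thesis
    using T unfolding \<rho>_def r rate_def share_def
    by (simp add: xarr_def weights_sym[of n h j i] power2_eq_square divide_simps)
qed

end

section \<open>Almost sure statements for the random process\<close>

locale network_process = network adj a p v0 + prob_space M
  for adj :: "'v::finite \<Rightarrow> 'v \<Rightarrow> bool" and a p v0 and M :: "'w measure" +
  fixes C :: "nat \<Rightarrow> 'w \<Rightarrow> 'v \<Rightarrow> 'v" and Wn :: "nat \<Rightarrow> 'w \<Rightarrow> 'v set"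
  assumes C_meas: "\<And>k. C k \<in> measurable M (count_space UNIV)"
    and W_meas: "\<And>k. Wn k \<in> measurable M (count_space UNIV)"
    and law: "\<And>n c w. measure M {\<omega> \<in> space M. \<forall>k<n. C k \<omega> = c k \<and> Wn k \<omega> = w k}
                = (\<Prod>k<n. p (w k) * (\<Prod>i\<in>UNIV. choice_prob (Vproc adj a v0 c w k) i (c k i)))"
begin

definition \<kappa> :: "nat \<Rightarrow> (nat \<Rightarrow> ('v \<Rightarrow> 'v) \<times> 'v set) \<Rightarrow> ('v \<Rightarrow> 'v) \<times> 'v set \<Rightarrow> real" where
  "\<kappa> n h s = p (snd s) * (\<Prod>i\<in>UNIV. choice_prob (weights n h) i (fst s i))"

text \<open>A letter is the choice function together with Nature's set, and the kernel sees the
  history only through the current weights.\<close>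

sublocale finite_history M "\<lambda>k \<omega>. (C k \<omega>, Wn k \<omega>)" \<kappa>
proof
  fix k
  show "(\<lambda>\<omega>. (C k \<omega>, Wn k \<omega>)) \<in> measurable M (count_space UNIV)"
  proof (subst measurable_count_space_eq2)
    show "(\<lambda>\<omega>. (C k \<omega>, Wn k \<omega>)) \<in> space M \<rightarrow> UNIV \<and>
      (\<forall>s\<in>UNIV. (\<lambda>\<omega>. (C k \<omega>, Wn k \<omega>)) -` {s} \<inter> space M \<in> sets M)"
    proof (intro conjI ballI)
      fix s :: "('v \<Rightarrow> 'v) \<times> 'v set"
      have "(\<lambda>\<omega>. (C k \<omega>, Wn k \<omega>)) -` {s} \<inter> space M
          = (C k -` {fst s} \<inter> space M) \<inter> (Wn k -` {snd s} \<inter> space M)"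
        by (simp add: set_eq_iff prod_eq_iff) blast
      also have "\<dots> \<in> sets M"
        by (intro sets.Int measurable_sets[OF C_meas] measurable_sets[OF W_meas]) auto
      finally show "(\<lambda>\<omega>. (C k \<omega>, Wn k \<omega>)) -` {s} \<inter> space M \<in> sets M" .
    qed auto
  qed auto
next
  fix n
  show "dep n (\<kappa> n)"
    using dep_comp[OF dep_weights[of n], of "\<lambda>V s. p (snd s) * (\<Prod>i\<in>UNIV. choice_prob V i (fst s i))"]
    by (simp add: \<kappa>_def[abs_def])
next
  fix n h s
  show "0 \<le> \<kappa> n h s"
    unfolding \<kappa>_def by (intro mult_nonneg_nonneg p_nonneg prod_nonneg choice_prob_nonneg weights_nonneg)
next
  fix n h
  have "(\<Sum>s\<in>UNIV. \<kappa> n h s) = (\<Sum>c\<in>UNIV. \<Sum>w\<in>UNIV. p w * (\<Prod>i\<in>UNIV. choice_prob (weights n h) i (c i)))"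
    by (simp add: sum_UNIV_prod \<kappa>_def)
  also have "\<dots> = (\<Sum>c\<in>UNIV. \<Prod>i\<in>UNIV. choice_prob (weights n h) i (c i))"
    by (simp add: p_sum flip: sum_distrib_right)
  also have "\<dots> = 1" by (simp add: sum_functions_prod choice_prob_sum)
  finally show "(\<Sum>s\<in>UNIV. \<kappa> n h s) = 1" .
next
  fix n h
  show "measure M {\<omega> \<in> space M. \<forall>k<n. (C k \<omega>, Wn k \<omega>) = h k} = (\<Prod>k<n. \<kappa> k h (h k))"
    using law[of n "\<lambda>k. fst (h k)" "\<lambda>k. snd (h k)"] by (simp add: \<kappa>_def weights_def prod_eq_iff)
qed

text \<open>Under the kernel Nature's set is independent of the choices, so the sum over letters
  factorises into \<open>pp adj p i j\<close> and the probability of mutual choice. The latter is a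
  product of two shares because distinct vertices choose independently.\<close>

lemma step_gain: "step n (\<lambda>h. gain n h i j) h = rt n h i j"
proof (cases "adj i j")
  case True
  let ?f = "choice_prob (weights n h)"
  have ij: "i \<noteq> j" using True adj_irrefl by auto
  have "step n (\<lambda>h. gain n h i j) h = (\<Sum>c\<in>UNIV. \<Sum>w\<in>UNIV. a i j * (p w * (if i \<in> w \<and> j \<in> w then 1 else 0))
      * ((\<Prod>k\<in>UNIV. ?f k (c k)) * (if c i = j \<and> c j = i then 1 else 0)))"
    unfolding step_def sum_UNIV_prod
    using True by (intro sum.cong refl) (auto simp: \<kappa>_def gain_def)
  also have "\<dots> = a i j * (\<Sum>w\<in>UNIV. p w * (if i \<in> w \<and> j \<in> w then 1 else 0))
      * (\<Sum>c\<in>UNIV. (\<Prod>k\<in>UNIV. ?f k (c k)) * (if c i = j \<and> c j = i then 1 else 0))"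
    by (simp only: sum_distrib_left sum_distrib_right)
  also have "(\<Sum>c\<in>UNIV. (\<Prod>k\<in>UNIV. ?f k (c k)) * (if c i = j \<and> c j = i then 1 else 0)) = ?f i j * ?f j i"
    by (rule sum_mutual_choice[OF choice_prob_sum ij])
  also have "(\<Sum>w\<in>UNIV. p w * (if i \<in> w \<and> j \<in> w then 1 else 0)) = pp adj p i j"
    using True by (simp add: pp_def if_distrib[of "\<lambda>x. _ * x"] sum.If_cases cong: if_cong)
  also have "?f i j = share (weights n h) i j"
    using wdeg_weights_pos[OF True, of n h] by (simp add: choice_prob_def share_def wdeg_def)
  also have "?f j i = share (weights n h) j i"
    using wdeg_weights_pos[of j i n h] True adj_sym[of i j] by (simp add: choice_prob_def share_def wdeg_def)
  finally show ?thesis by (simp add: rate_def q_def)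
next
  case False
  then have "q i j = 0" using q_pos_adj by blast
  with False show ?thesis by (simp add: step_def gain_def rate_def)
qed

lemma dep_gain_entry: "dep (Suc k) (\<lambda>h. gain k h i j)"
  using dep_comp[OF dep_gain] .

lemma dep_rt: "dep k (\<lambda>h. rt k h i j)"
  using dep_comp[OF dep_weights] .

text \<open>Gains are bounded, so divided by \<open>Suc k\<close> they have a deterministic bound on
  the sum of squares, and their compensated series converges.\<close>

lemma AE_noise: "AE \<omega> in M. convergent (\<lambda>n. \<Sum>k<n.
    (weights (Suc k) (path \<omega>) i j - weights k (path \<omega>) i j - rt k (path \<omega>) i j) / real (Suc k))"
proof -
  let ?f = "\<lambda>k h. (1 / real (Suc k)) * gain k h i j"
  have dep: "dep (Suc k) (?f k)" for k by (intro dep_mult dep_const dep_gain_entry)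
  obtain B where B: "\<And>n. (\<Sum>k<n. (1 / real (Suc k))\<^sup>2) \<le> B" using sum_inverse_squares_bound by blast
  have bound: "(\<Sum>k<n. (?f k h)\<^sup>2) \<le> B * A\<^sup>2" for n h
  proof -
    have "(\<Sum>k<n. (?f k h)\<^sup>2) \<le> (\<Sum>k<n. (1 / real (Suc k))\<^sup>2 * A\<^sup>2)"
      unfolding power_mult_distrib
      by (intro sum_mono mult_left_mono power_mono gain_le gain_nonneg) auto
    also have "\<dots> \<le> B * A\<^sup>2"
      unfolding sum_distrib_right[symmetric] by (intro mult_right_mono B) auto
    finally show ?thesis .
  qed
  have "step k (?f k) h = rt k h i j / real (Suc k)" for k h
    by (simp only: step_cmult step_gain) simp
  with compensated_convergence[OF dep bound] show ?thesis
    by (simp add: weights_Suc diff_divide_distrib)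
qed

text \<open>\<open>drate\<close> is linear in the direction, and the weights at time
  \<open>k\<close> are known before the step, so the conditional mean passes to the
  direction.\<close>

lemma step_drate_gain: "step k (\<lambda>h. drate q (weights k h) (gain k h) i j) h = drate q (weights k h) (rt k h) i j"
proof -
  have up: "weights k (h(k := s)) = weights k h" for s by (rule dep_upd[OF dep_weights])
  have row: "step k (\<lambda>h. wdeg (gain k h) i) h = wdeg (rt k h) i" for i
    by (simp add: wdeg_def step_sum step_gain)
  have ds: "step k (\<lambda>h. dshare (weights k h) (gain k h) i j) h = dshare (weights k h) (rt k h) i j" for i j
  proof -
    have "step k (\<lambda>h. dshare (weights k h) (gain k h) i j) h
        = step k (\<lambda>h'. (1 / wdeg (weights k h) i) * (gain k h' i j - share (weights k h) i j * wdeg (gain k h') i)) h"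
      by (rule step_cong) (simp add: up dshare_def)
    also have "\<dots> = dshare (weights k h) (rt k h) i j"
      by (simp only: step_cmult step_diff step_gain row dshare_def) simp
    finally show ?thesis .
  qed
  have "step k (\<lambda>h. drate q (weights k h) (gain k h) i j) h
      = step k (\<lambda>h'. q i j * (share (weights k h) i j * dshare (weights k h') (gain k h') j i
          + share (weights k h) j i * dshare (weights k h') (gain k h') i j)) h"
    by (rule step_cong) (simp add: up drate_def)
  then show ?thesis by (simp add: step_cmult step_add ds drate_def)
qed

text \<open>An increment of the rate is a martingale difference plus its conditional mean. That mean
  differs from the drift by at most a multiple of the conditional mean of the jumps, which is
  summable almost surely.\<close>

lemma AE_drift: "AE \<omega> in M. convergent (\<lambda>n. \<Sum>k<n. rt (Suc k) (path \<omega>) i j - rt k (path \<omega>) i j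
    - drate q (weights k (path \<omega>)) (rt k (path \<omega>)) i j)"
proof -
  let ?f = "\<lambda>k h. rt (Suc k) h i j - rt k h i j"
  let ?g = "\<lambda>k h. drate q (weights k h) (gain k h) i j"
  let ?J = "\<lambda>k h. jump i k h + jump j k h"
  obtain B1 where B1: "\<And>n h. (\<Sum>k<n. jump i k h) \<le> B1" using jump_summable by blast
  obtain B2 where B2: "\<And>n h. (\<Sum>k<n. jump j k h) \<le> B2" using jump_summable by blast
  have J: "(\<Sum>k<n. ?J k h) \<le> B1 + B2" for n h
    using add_mono[OF B1 B2] by (simp add: sum.distrib)
  have dJ: "dep (Suc k) (?J k)" for k by (rule dep_comp2[OF dep_jump dep_jump])
  have df: "dep (Suc k) (?f k)" for k
    by (intro dep_diff dep_rt dep_mono[OF dep_rt]) auto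
  have bound: "(\<Sum>k<n. (?f k h)\<^sup>2) \<le> 2 * (q i j)\<^sup>2 * (B1 + B2)" for n h
  proof -
    have "(\<Sum>k<n. (?f k h)\<^sup>2) \<le> (\<Sum>k<n. 2 * (q i j)\<^sup>2 * ?J k h)"
      by (intro sum_mono rate_weights_Suc)
    also have "\<dots> \<le> 2 * (q i j)\<^sup>2 * (B1 + B2)"
      unfolding sum_distrib_left[symmetric] by (intro mult_left_mono J) auto
    finally show ?thesis .
  qed
  have mart: "AE \<omega> in M. convergent (\<lambda>n. \<Sum>k<n. ?f k (path \<omega>) - step k (?f k) (path \<omega>))"
    by (rule compensated_convergence[OF df bound])
  have summ: "AE \<omega> in M. summable (\<lambda>k. step k (?J k) (path \<omega>))"
    by (rule AE_summable_step[OF dJ _ J]) (simp add: jump_nonneg)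
  have err: "\<bar>step k (?f k) h - drate q (weights k h) (rt k h) i j\<bar> \<le> 2 * q i j * step k (?J k) h" for k h
  proof -
    have "step k (?f k) h - drate q (weights k h) (rt k h) i j = step k (\<lambda>h. ?f k h - ?g k h) h"
      by (simp only: step_diff step_drate_gain)
    moreover have "\<bar>step k (\<lambda>h. ?f k h - ?g k h) h\<bar> \<le> step k (\<lambda>h. \<bar>?f k h - ?g k h\<bar>) h"
      by (rule abs_step_le)
    moreover have "step k (\<lambda>h. \<bar>?f k h - ?g k h\<bar>) h \<le> step k (\<lambda>h. 2 * q i j * ?J k h) h"
      by (intro step_mono rate_weights_Suc)
    moreover have "step k (\<lambda>h. 2 * q i j * ?J k h) h = 2 * q i j * step k (?J k) h"
      by (rule step_cmult)
    ultimately show ?thesis by linarith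
  qed
  from mart summ show ?thesis
  proof eventually_elim
    case (elim \<omega>)
    let ?e = "\<lambda>k. step k (?f k) (path \<omega>) - drate q (weights k (path \<omega>)) (rt k (path \<omega>)) i j"
    have "summable ?e"
    proof (rule summable_comparison_test'[where N = 0])
      show "summable (\<lambda>k. 2 * q i j * step k (?J k) (path \<omega>))"
        using elim(2) by (rule summable_mult)
      show "norm (?e k) \<le> 2 * q i j * step k (?J k) (path \<omega>)" for k
        unfolding real_norm_def by (rule err)
    qed
    then have "convergent (\<lambda>n. \<Sum>k<n. ?e k)" by (simp only: summable_iff_convergent)
    from convergent_add[OF elim(1) this] show ?case
      unfolding sum.distrib[symmetric] by (simp only: add_diff_eq diff_add_cancel)
  qed
qed

text \<open>The gain is nonnegative and has mean zero, since its conditional mean is the rate, which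
  contains the factor \<open>q i j\<close>.\<close>

lemma AE_frozen:
  assumes "q i j = 0"
  shows "AE \<omega> in M. gain k (path \<omega>) i j = 0"
proof -
  have "expectation (\<lambda>\<omega>. gain k (path \<omega>) i j) = expectation (\<lambda>\<omega>. rt k (path \<omega>) i j)"
    using expectation_step[OF dep_gain_entry, of k i j] by (simp add: step_gain)
  also have "\<dots> = 0" by (simp add: rate_def assms)
  finally show ?thesis
    by (subst (asm) integral_nonneg_eq_0_iff_AE)
       (auto intro: path_integrable[OF dep_gain_entry] simp: gain_nonneg)
qed

lemma AE_convergence: "AE \<omega> in M.
    (\<lambda>n. Fmap adj a p (xarr (weights n (path \<omega>)))) \<longlonglongrightarrow> 0 \<and>
    (\<lambda>n. infdist (xarr (weights n (path \<omega>))) (Gamma adj a p v0)) \<longlonglongrightarrow> 0"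
proof -
  obtain c where c: "0 < c" "\<And>x. x \<in> Delta adj a p v0 \<Longrightarrow> c \<le> (\<Sum>i\<in>UNIV. \<Sum>j\<in>UNIV. \<rho> x i j)"
    using Hfun_lower by blast
  have "AE \<omega> in M. \<forall>i j. convergent (\<lambda>n. \<Sum>k<n.
      (weights (Suc k) (path \<omega>) i j - weights k (path \<omega>) i j - rt k (path \<omega>) i j) / real (Suc k))"
    by (intro eventually_all_finite AE_noise)
  moreover have "AE \<omega> in M. \<forall>i j. convergent (\<lambda>n. \<Sum>k<n. rt (Suc k) (path \<omega>) i j - rt k (path \<omega>) i j
      - drate q (weights k (path \<omega>)) (rt k (path \<omega>)) i j)"
    by (intro eventually_all_finite AE_drift)
  moreover have "AE \<omega> in M. \<forall>k i j. q i j = 0 \<longrightarrow> gain k (path \<omega>) i j = 0"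
    unfolding AE_all_countable[of "\<lambda>k \<omega>. \<forall>i j. q i j = 0 \<longrightarrow> gain k (path \<omega>) i j = 0"]
    by (intro allI eventually_all_finite) (auto intro: AE_frozen)
  ultimately show ?thesis
  proof eventually_elim
    case (elim \<omega>)
    let ?V = "\<lambda>n. weights n (path \<omega>)"
    have D: "xarr (?V n) \<in> Delta adj a p v0" for n
      using elim(3) by (intro xarr_Delta) blast
    \<comment> \<open>From here on the trajectory is fixed and the argument is
      deterministic.\<close>
    interpret reinforced_path q ?V A c
    proof
      fix n i j
      show "0 \<le> q i j" by (rule q_nonneg)
      show "q i j = q j i" by (rule q_sym)
      show "0 \<le> ?V n i j" by (rule weights_nonneg)
      show "?V n i j = ?V n j i" by (rule weights_sym)
      show "?V n i j \<le> ?V (Suc n) i j" by (simp add: weights_Suc gain_nonneg)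
      show "?V (Suc n) i j \<le> ?V n i j + A" by (simp add: weights_Suc gain_le)
      show "1 \<le> A" by (rule A_ge_1)
      show "convergent (\<lambda>n. \<Sum>k<n. (?V (Suc k) i j - ?V k i j - rate q (?V k) i j) / real (Suc k))"
        using elim(1) by blast
      show "convergent (\<lambda>n. \<Sum>k<n. rate q (?V (Suc k)) i j - rate q (?V k) i j
          - drate q (?V k) (rate q (?V k)) i j)"
        using elim(2) by blast
      show "0 < c" by (rule c(1))
      show "c \<le> (\<Sum>i\<in>UNIV. \<Sum>j\<in>UNIV. rate q (?V n) i j)"
        using c(2)[OF D[of n]] by (simp add: \<rho>_xarr)
    qed
    have Hf: "Hfun adj a p (xarr (?V n)) = H n" for n
      by (simp add: Hfun_eq[OF D] \<rho>_xarr H_def)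
    have "Fmap adj a p (xarr (?V n)) $ i $ j = r n i j - ?V n i j / total n * H n" for n i j
      by (simp add: Fmap_eq[OF D] Hf \<rho>_xarr) (simp add: xarr_def total_def)
    then have F: "(\<lambda>n. Fmap adj a p (xarr (?V n))) \<longlonglongrightarrow> 0"
      using drift_vanishes by (intro vec_tendstoI) simp
    moreover have "(\<lambda>n. infdist (xarr (?V n)) (Gamma adj a p v0)) \<longlonglongrightarrow> 0"
      using H_convergent by (intro infdist_Gamma_tendsto D F) (simp add: Hf)
    ultimately show ?case by blast
  qed
qed

end

theorem theorem2:
  fixes adj :: "'v::finite \<Rightarrow> 'v \<Rightarrow> bool"
    and a :: "'v \<Rightarrow> 'v \<Rightarrow> real"
    and p :: "'v set \<Rightarrow> real"
    and v0 :: "'v \<Rightarrow> 'v \<Rightarrow> real"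
    and M :: "'w measure"
    and C :: "nat \<Rightarrow> 'w \<Rightarrow> 'v \<Rightarrow> 'v"
    and Wn :: "nat \<Rightarrow> 'w \<Rightarrow> 'v set"
  assumes adj_sym: "\<And>i j. adj i j \<longleftrightarrow> adj j i"
    and adj_irrefl: "\<And>i. \<not> adj i i"
    and a_nonneg: "\<And>i j. a i j \<ge> 0"
    and a_sym: "\<And>i j. a i j = a j i"
    and a_adj: "\<And>i j. a i j > 0 \<Longrightarrow> adj i j"
    and p_nonneg: "\<And>W. p W \<ge> 0"
    and p_sum: "(\<Sum>W\<in>UNIV. p W) = 1"
    and ap_pos: "\<exists>i j. a i j * pp adj p i j > 0"
    and v0_sym: "\<And>i j. v0 i j = v0 j i"
    and v0_nonneg: "\<And>i j. v0 i j \<ge> 0"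
    and v0_pos: "\<And>i j. v0 i j > 0 \<longleftrightarrow> adj i j"
    and M: "prob_space M"
    and C_meas: "\<And>k. C k \<in> measurable M (count_space UNIV)"
    and W_meas: "\<And>k. Wn k \<in> measurable M (count_space UNIV)"
    and law: "\<And>n c w. measure M {\<omega> \<in> space M. \<forall>k<n. C k \<omega> = c k \<and> Wn k \<omega> = w k}
                = (\<Prod>k<n. p (w k) * (\<Prod>i\<in>UNIV. choice_prob (Vproc adj a v0 c w k) i (c k i)))"
  shows "AE \<omega> in M.
           ((\<lambda>n. Fmap adj a p (xarr (Vproc adj a v0 (\<lambda>k. C k \<omega>) (\<lambda>k. Wn k \<omega>) n))) \<longlonglongrightarrow> 0)
         \<and> ((\<lambda>n. infdist (xarr (Vproc adj a v0 (\<lambda>k. C k \<omega>) (\<lambda>k. Wn k \<omega>) n)) (Gamma adj a p v0))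
               \<longlonglongrightarrow> 0)"
proof -
  interpret prob_space M by (rule M)
  interpret network_process adj a p v0 M C Wn
    by unfold_locales (fact assms)+
  show ?thesis using AE_convergence by (simp only: weights_def fst_conv snd_conv)
qed

end
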